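(* Let $d \geq 2$ and let $\mu$ be a compactly supported (nonnegative) Radon measure on $\mathbb{R}^{d}$ such that $I_{s}(\mu) < \infty$ for some $s > d - 1$. Let $$\mathcal{S}(\mu) := \{x \in \mathbb{R}^{d} \setminus \operatorname{spt} \mu : \pi_{x\sharp}\mu \text{ is not absolutely continuous with respect to } \mathcal{H}^{d - 1}|_{S^{d - 1}}\}.$$ Then $\dim_{\mathrm{H}} \mathcal{S}(\mu) \leq 2(d - 1) - s$.
   Context: For $x \in \mathbb{R}^{d}$, $\pi_{x} \colon \mathbb{R}^{d} \setminus \{x\} \to S^{d - 1}$ is the radial projection $\pi_{x}(y) = (y - x)/|y - x|$. For $x \notin \operatorname{spt}\mu$, $\pi_{x}$ is continuous on $\operatorname{spt}\mu$ and $\pi_{x\sharp}\mu$ denotes the push-forward measure on $S^{d-1}$. The $s$-energy of $\mu$ is $I_{s}(\mu) = \iint |x - y|^{-s} \, d\mu(x) \, d\mu(y)$. $\mathcal{H}^{d-1}$ is $(d-1)$-dimensional Hausdorff measure and $\dim_{\mathrm{H}}$ is Hausdorff dimension. *)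

theory Defs
  imports "HOL-Analysis.Analysis"
begin

definition spt :: "'a::metric_space measure \<Rightarrow> 'a set" where
  "spt \<mu> = {x. \<forall>e>0. emeasure \<mu> (ball x e) \<noteq> 0}"

definition riesz_kernel :: "real \<Rightarrow> 'a::metric_space \<Rightarrow> 'a \<Rightarrow> ennreal" where
  "riesz_kernel s x y = (if x = y then \<infinity> else ennreal (dist x y powr (- s)))"

definition energy :: "real \<Rightarrow> 'a::metric_space measure \<Rightarrow> ennreal" where
  "energy s \<mu> = (\<integral>\<^sup>+ x. (\<integral>\<^sup>+ y. riesz_kernel s x y \<partial>\<mu>) \<partial>\<mu>)"

definition radial_proj :: "'a::real_normed_vector \<Rightarrow> 'a \<Rightarrow> 'a" where
  "radial_proj x y = (1 / norm (y - x)) *\<^sub>R (y - x)"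

definition hausdorff_pre :: "real \<Rightarrow> real \<Rightarrow> 'a::metric_space set \<Rightarrow> ennreal" where
  "hausdorff_pre s \<delta> A =
     (INF C \<in> {C :: nat \<Rightarrow> 'a set. A \<subseteq> (\<Union>i. C i) \<and> (\<forall>i. bounded (C i) \<and> diameter (C i) \<le> \<delta>)}.
        (\<Sum>i. ennreal (diameter (C i) powr s)))"

definition hausdorff_measure :: "real \<Rightarrow> 'a::metric_space set \<Rightarrow> ennreal" where
  "hausdorff_measure s A = (SUP \<delta> \<in> {0<..}. hausdorff_pre s \<delta> A)"

definition hausdorff_dim :: "'a::metric_space set \<Rightarrow> ereal" where
  "hausdorff_dim A =
     (if A = {} then - \<infinity> else Inf {ereal t | t. 0 \<le> t \<and> hausdorff_measure t A = 0})"

definition ac_sphere_hausdorff :: "'a::euclidean_space measure \<Rightarrow> bool" where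
  "ac_sphere_hausdorff \<nu> \<longleftrightarrow>
     (\<forall>A \<in> sets borel.
        hausdorff_measure (real (DIM('a)) - 1) (A \<inter> sphere 0 1) = 0 \<longrightarrow> emeasure \<nu> A = 0)"

definition exc_set :: "'a::euclidean_space measure \<Rightarrow> 'a set" where
  "exc_set \<mu> = {x. x \<notin> spt \<mu> \<and> \<not> ac_sphere_hausdorff (distr \<mu> borel (radial_proj x))}"

end

theory Submission
  imports Defs "HOL-Probability.Distributions"
begin

text \<open>
  Let \<open>d\<close> be the dimension and \<open>m = d - 1\<close>. The mass of \<open>\<mu>\<close> near the line through \<open>x\<close> with direction
  \<open>v\<close> is measured by the Gaussian average \<open>F a x v\<close> of \<open>\<mu>\<close> against
  \<open>a powr (- m/2) * exp (- pi * (|u|^2 |v|^2 - (u \<bullet> v)^2) / a)\<close>, \<open>u = y - x\<close>, and directions are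
  weighted by \<open>exp (- pi * |v|^2)\<close>. With these choices everything is explicit: integrating over \<open>v\<close>
  turns the kernel into \<open>(a + |u|^2) powr (- m/2)\<close>, and for fixed \<open>v\<close> the kernels form a convolution
  semigroup in \<open>a\<close>.

  If the \<open>L^1\<close> norms over \<open>v\<close> of \<open>F (r^2/4) x - F (r^2) x\<close> are summable over \<open>r = 2^-k\<close>, then
  \<open>F a x\<close> converges in \<open>L^1\<close>, and hence \<open>\<mu>\<close> gives no mass to cones with apex \<open>x\<close> over null sets of
  directions. To bound the set of \<open>x\<close> where summability fails, put Frostman weights of exponent \<open>t\<close> on
  a finite \<open>r\<close>-net of the set where the \<open>L^1\<close> norm is large. By the semigroup property and
  Cauchy-Schwarz over the space of lines, the weighted sum of the \<open>L^1\<close> norms is at most the product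
  of two square roots. One comes from the second difference
  of \<open>a \<mapsto> (a + |u|^2) powr (- m/2)\<close> integrated against \<open>\<mu> \<times> \<mu>\<close>, which is \<open>O(r powr (s - m))\<close> by the
  energy assumption; the other is the discrete energy of the weights, which is \<open>O(r powr (t - m))\<close>.
  For \<open>t > 2 m - s\<close> the product decays geometrically, so the exceptional set has zero \<open>t\<close>-dimensional
  measure. For \<open>s > d\<close> finite energy forces \<open>\<mu> = 0\<close>.
\<close>

subsection \<open>Anisotropic Gaussian integrals\<close>

lemma nn_integral_gaussian_real:
  fixes b c :: real
  assumes "b > 0"
  shows "(\<integral>\<^sup>+x. ennreal (exp (- (pi * b * (x - c)\<^sup>2))) \<partial>lborel) = ennreal (b powr (-1/2))"
proof -
  define \<sigma> where "\<sigma> = 1 / sqrt (2 * pi * b)"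
  have \<sigma>: "\<sigma> > 0" "2 * \<sigma>\<^sup>2 = 1 / (pi * b)"
    using assms by (auto simp: \<sigma>_def power_divide field_simps)
  have "normal_density c \<sigma> x = sqrt b * exp (- (pi * b * (x - c)\<^sup>2))" for x
  proof -
    have "2 * pi * \<sigma>\<^sup>2 = 1 / b"
      using \<sigma>(2) assms by (simp add: field_simps)
    then have "normal_density c \<sigma> x = 1 / sqrt (1 / b) * exp (- (x - c)\<^sup>2 / (1 / (pi * b)))"
      unfolding normal_density_def \<sigma>(2)[symmetric] by simp
    then show ?thesis
      using assms by (simp add: real_sqrt_divide field_simps)
  qed
  then have e: "exp (- (pi * b * (x - c)\<^sup>2)) = b powr (-1/2) * normal_density c \<sigma> x" for x
    using assms by (simp add: powr_minus powr_half_sqrt)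
  have "emeasure (density lborel (normal_density c \<sigma>)) (space (density lborel (normal_density c \<sigma>))) = 1"
    using prob_space.emeasure_space_1[OF prob_space_normal_density[OF \<sigma>(1)]] .
  then have 1: "(\<integral>\<^sup>+x. ennreal (normal_density c \<sigma> x) \<partial>lborel) = 1"
    by (simp add: emeasure_density)
  show ?thesis
    unfolding e using 1 by (simp add: ennreal_mult nn_integral_cmult)
qed

lemma nn_integral_lborel_translation:
  fixes f :: "'a::euclidean_space \<Rightarrow> ennreal"
  assumes [measurable]: "f \<in> borel_measurable borel"
  shows "(\<integral>\<^sup>+x. f (x + c) \<partial>lborel) = (\<integral>\<^sup>+x. f x \<partial>lborel)"
proof -
  have "(\<integral>\<^sup>+x. f x \<partial>lborel) = (\<integral>\<^sup>+x. f x \<partial>(distr lborel borel ((+) c)))"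
    by (simp add: lborel_distr_plus)
  also have "\<dots> = (\<integral>\<^sup>+x. f (c + x) \<partial>lborel)"
    by (rule nn_integral_distr) simp_all
  finally show ?thesis by (simp add: add.commute)
qed

lemma nn_integral_gaussian:
  fixes c :: "'a::euclidean_space"
  assumes "b > 0"
  shows "(\<integral>\<^sup>+x. ennreal (exp (- (pi * b * (norm (x - c))\<^sup>2))) \<partial>lborel) = ennreal (b powr (-(real DIM('a))/2))"
proof -
  have "ennreal (exp (- (pi * b * (norm (x - c))\<^sup>2)))
      = (\<Prod>i\<in>Basis. ennreal (exp (- (pi * b * (x \<bullet> i - c \<bullet> i)\<^sup>2))))" for x :: 'a
  proof -
    have "- (pi * b * (norm (x - c))\<^sup>2) = (\<Sum>i\<in>Basis. - (pi * b * (x \<bullet> i - c \<bullet> i)\<^sup>2))"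
      unfolding power2_norm_eq_inner euclidean_inner[of "x - c" "x - c"]
      by (simp add: sum_distrib_left sum_negf inner_diff_left power2_eq_square)
    then show ?thesis
      by (simp add: exp_sum prod_ennreal)
  qed
  then have "(\<integral>\<^sup>+x. ennreal (exp (- (pi * b * (norm (x - c))\<^sup>2))) \<partial>lborel)
     = (\<integral>\<^sup>+x. (\<Prod>i\<in>Basis. ennreal (exp (- (pi * b * (x \<bullet> i - c \<bullet> i)\<^sup>2)))) \<partial>lborel)" by simp
  also have "\<dots> = (\<Prod>i\<in>(Basis::'a set). \<integral>\<^sup>+x. ennreal (exp (- (pi * b * (x - c \<bullet> i)\<^sup>2))) \<partial>lborel)"
    by (subst nn_integral_lborel_prod) auto
  also have "\<dots> = ennreal (b powr (-1/2)) ^ DIM('a)"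
    using assms by (simp add: nn_integral_gaussian_real)
  also have "\<dots> = ennreal (b powr (-(real DIM('a))/2))"
    using assms by (simp add: ennreal_power powr_power)
  finally show ?thesis .
qed

text \<open>The quadratic form has eigenvalue \<open>l\<close> on the complement of \<open>p\<close>
  and \<open>l - (norm p)\<^sup>2\<close> along \<open>p\<close>, so the right side is the inverse
  square root of its determinant. The hypothesis says that the form is positive definite.\<close>

lemma nn_integral_anisotropic_gaussian:
  fixes p :: "'a::euclidean_space"
  assumes "(norm p)\<^sup>2 < l"
  shows "(\<integral>\<^sup>+h. ennreal (exp (- (pi * (l * (norm h)\<^sup>2 - (h \<bullet> p)\<^sup>2)))) \<partial>lborel)
       = ennreal (l powr (-(real DIM('a) - 1)/2) * (l - (norm p)\<^sup>2) powr (-1/2))"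
proof -
  have l: "l > 0"
    using assms by (smt (verit) zero_le_power2)
  \<comment> \<open>Write \<open>exp (pi * (h \<bullet> p)^2)\<close> as a Gaussian integral over an auxiliary real \<open>\<tau>\<close> and integrate over \<open>h\<close> first.\<close>
  have sq: "l * (norm h)\<^sup>2 - (h \<bullet> p)\<^sup>2 + (\<tau> - h \<bullet> p)\<^sup>2
      = l * (norm (h - (\<tau> / l) *\<^sub>R p))\<^sup>2 + ((l - (norm p)\<^sup>2) / l) * (\<tau> - 0)\<^sup>2" for h \<tau>
    using l unfolding power2_norm_eq_inner
    by (simp add: inner_diff_left inner_diff_right inner_commute power2_eq_square field_simps)
  have "(\<integral>\<^sup>+h. ennreal (exp (- (pi * (l * (norm h)\<^sup>2 - (h \<bullet> p)\<^sup>2)))) \<partial>lborel)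
     = (\<integral>\<^sup>+h. (\<integral>\<^sup>+\<tau>. ennreal (exp (- (pi * (l * (norm h)\<^sup>2 - (h \<bullet> p)\<^sup>2)))) * ennreal (exp (- (pi * 1 * (\<tau> - h \<bullet> p)\<^sup>2))) \<partial>lborel) \<partial>lborel)"
    by (subst nn_integral_cmult) (simp_all only: nn_integral_gaussian_real, simp_all)
  also have "\<dots> = (\<integral>\<^sup>+\<tau>. (\<integral>\<^sup>+h. ennreal (exp (- (pi * (l * (norm h)\<^sup>2 - (h \<bullet> p)\<^sup>2)))) * ennreal (exp (- (pi * 1 * (\<tau> - h \<bullet> p)\<^sup>2))) \<partial>lborel) \<partial>lborel)"
    by (rule lborel_pair.Fubini') measurable
  also have "\<dots> = (\<integral>\<^sup>+\<tau>. (\<integral>\<^sup>+h. ennreal (exp (- (pi * ((l - (norm p)\<^sup>2) / l) * (\<tau> - 0)\<^sup>2))) *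
            ennreal (exp (- (pi * l * (norm (h - (\<tau> / l) *\<^sub>R p))\<^sup>2))) \<partial>lborel) \<partial>lborel)"
  proof (intro nn_integral_cong)
    fix \<tau> h
    have "exp (- (pi * (l * (norm h)\<^sup>2 - (h \<bullet> p)\<^sup>2))) * exp (- (pi * 1 * (\<tau> - h \<bullet> p)\<^sup>2))
       = exp (- (pi * (l * (norm h)\<^sup>2 - (h \<bullet> p)\<^sup>2 + (\<tau> - h \<bullet> p)\<^sup>2)))"
      by (simp add: exp_add[symmetric] algebra_simps)
    also have "\<dots> = exp (- (pi * ((l - (norm p)\<^sup>2) / l) * (\<tau> - 0)\<^sup>2)) * exp (- (pi * l * (norm (h - (\<tau> / l) *\<^sub>R p))\<^sup>2))"
      unfolding sq by (simp add: exp_add[symmetric] algebra_simps)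
    finally show "ennreal (exp (- (pi * (l * (norm h)\<^sup>2 - (h \<bullet> p)\<^sup>2)))) * ennreal (exp (- (pi * 1 * (\<tau> - h \<bullet> p)\<^sup>2)))
      = ennreal (exp (- (pi * ((l - (norm p)\<^sup>2) / l) * (\<tau> - 0)\<^sup>2))) * ennreal (exp (- (pi * l * (norm (h - (\<tau> / l) *\<^sub>R p))\<^sup>2)))"
      by (simp add: ennreal_mult[symmetric])
  qed
  also have "\<dots> = (\<integral>\<^sup>+\<tau>. ennreal (exp (- (pi * ((l - (norm p)\<^sup>2) / l) * (\<tau> - 0)\<^sup>2))) \<partial>lborel)
           * ennreal (l powr (-(real DIM('a))/2))"
    using l by (simp add: nn_integral_cmult nn_integral_multc nn_integral_gaussian del: diff_zero)
  also have "\<dots> = ennreal (((l - (norm p)\<^sup>2) / l) powr (-1/2)) * ennreal (l powr (-(real DIM('a))/2))"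
    using l assms by (subst nn_integral_gaussian_real) auto
  also have "\<dots> = ennreal (l powr (-(real DIM('a) - 1)/2) * (l - (norm p)\<^sup>2) powr (-1/2))"
  proof -
    have "((l - (norm p)\<^sup>2) / l) powr (-1/2) = (l - (norm p)\<^sup>2) powr (-1/2) * l powr (1/2)"
      using l assms by (simp add: powr_divide powr_minus divide_simps)
    moreover have "l powr (1/2) * l powr (-(real DIM('a))/2) = l powr (-(real DIM('a) - 1)/2)"
      by (simp add: powr_add[symmetric] field_simps)
    ultimately show ?thesis
      by (simp add: ennreal_mult[symmetric] mult.assoc)
  qed
  finally show ?thesis .
qed

subsection \<open>The line kernel\<close>

text \<open>The Gram determinant of \<open>u\<close> and \<open>v\<close>, that is,
  \<open>(norm v)\<^sup>2\<close> times the squared distance from \<open>u\<close> to the line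
  spanned by \<open>v\<close>.\<close>

definition gram :: "'a::real_inner \<Rightarrow> 'a \<Rightarrow> real" where
  "gram u v = (norm u)\<^sup>2 * (norm v)\<^sup>2 - (u \<bullet> v)\<^sup>2"

text \<open>For a unit vector \<open>v\<close> this is a Gaussian probability density on the
  hyperplane orthogonal to \<open>v\<close>, extended constantly along \<open>v\<close>. The
  parameter \<open>a\<close> is the time of a heat semigroup and also the squared width of a
  tube.\<close>

definition line_kernel :: "real \<Rightarrow> 'a::euclidean_space \<Rightarrow> 'a \<Rightarrow> real" where
  "line_kernel a v u = a powr (-(real DIM('a) - 1)/2) * exp (- (pi * (gram u v / a)))"

text \<open>The line kernel is constant along \<open>v\<close>. This weight makes it integrable in that direction, so that
  integrals over the space of lines become integrals over the whole space; the power of \<open>norm v\<close> makes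
  the semigroup property exact.\<close>

definition slab_weight :: "'a::euclidean_space \<Rightarrow> 'a \<Rightarrow> real" where
  "slab_weight v h = norm v ^ DIM('a) * exp (- (pi * (h \<bullet> v)\<^sup>2))"

text \<open>Letting \<open>v\<close> range over the whole space with this weight, instead of over
  the sphere, turns averages over directions into explicit Gaussian integrals.\<close>

definition gauss_weight :: "'a::real_inner \<Rightarrow> real" where
  "gauss_weight v = exp (- (pi * (norm v)\<^sup>2))"

lemma gram_nonneg: "gram u v \<ge> 0"
  using Cauchy_Schwarz_ineq[of u v] by (simp add: gram_def power2_norm_eq_inner)

lemma gram_minus: "gram (- u) v = gram u v"
  by (simp add: gram_def)

lemma gram_measurable [measurable (raw)]:
  fixes f g :: "'b \<Rightarrow> 'a::euclidean_space"
  assumes [measurable]: "f \<in> borel_measurable M" "g \<in> borel_measurable M"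
  shows "(\<lambda>x. gram (f x) (g x)) \<in> borel_measurable M"
  unfolding gram_def by measurable

lemma line_kernel_nonneg [simp]: "line_kernel a v u \<ge> 0"
  by (simp add: line_kernel_def)

lemma line_kernel_minus: "line_kernel a v (- u) = line_kernel a v u"
  by (simp add: line_kernel_def gram_minus)

lemma line_kernel_le: "a > 0 \<Longrightarrow> line_kernel a v u \<le> a powr (-(real DIM('a) - 1)/2)"
  for v u :: "'a::euclidean_space"
  unfolding line_kernel_def using gram_nonneg[of u v]
  by (intro mult_left_le) auto

lemma line_kernel_measurable [measurable (raw)]:
  fixes f g :: "'b \<Rightarrow> 'a::euclidean_space"
  assumes [measurable]: "f \<in> borel_measurable M" "g \<in> borel_measurable M"
  shows "(\<lambda>x. line_kernel a (f x) (g x)) \<in> borel_measurable M"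
  unfolding line_kernel_def by measurable

lemma slab_weight_nonneg [simp]: "slab_weight v h \<ge> 0"
  by (simp add: slab_weight_def)

lemma slab_weight_measurable [measurable (raw)]:
  fixes f g :: "'b \<Rightarrow> 'a::euclidean_space"
  assumes [measurable]: "f \<in> borel_measurable M" "g \<in> borel_measurable M"
  shows "(\<lambda>x. slab_weight (f x) (g x)) \<in> borel_measurable M"
  unfolding slab_weight_def by measurable

lemma gauss_weight_nonneg [simp]: "gauss_weight v \<ge> 0"
  by (simp add: gauss_weight_def)

lemma gauss_weight_measurable [measurable (raw)]:
  fixes f :: "'b \<Rightarrow> 'a::euclidean_space"
  assumes [measurable]: "f \<in> borel_measurable M"
  shows "(\<lambda>x. gauss_weight (f x)) \<in> borel_measurable M"
  unfolding gauss_weight_def by measurable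

text \<open>The shift \<open>c\<close> is the minimiser of the quadratic form: the weighted mean of \<open>x\<close> and \<open>y\<close>,
  projected onto the orthogonal complement of \<open>v\<close>, where \<open>gram _ v\<close> is definite.\<close>

lemma gram_complete_square:
  fixes x y v g :: "'a::real_inner" and a b :: real
  assumes "a > 0" "b > 0" "v \<noteq> 0"
  defines "m \<equiv> (1 / (a + b)) *\<^sub>R (b *\<^sub>R x + a *\<^sub>R y)"
  defines "c \<equiv> m - ((m \<bullet> v) / (norm v)\<^sup>2) *\<^sub>R v"
  shows "gram (g + c - x) v / a + gram (g + c - y) v / b + ((g + c) \<bullet> v)\<^sup>2
       = (1/a + 1/b) * gram g v + (g \<bullet> v)\<^sup>2 + gram (x - y) v / (a + b)"
proof -
  have nv: "v \<bullet> v > 0"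
    using assms(3) by simp
  have shift: "gram (u + k *\<^sub>R v) v = gram u v" for u k
    unfolding gram_def power2_norm_eq_inner
    by (simp add: inner_add_left inner_add_right inner_commute power2_eq_square algebra_simps)
  \<comment> \<open>The mean lies at \<open>a *\<^sub>R w\<close> from \<open>x\<close> and at
    \<open>- (b *\<^sub>R w)\<close> from \<open>y\<close>; after division by \<open>a\<close> and
    \<open>b\<close> the terms linear in \<open>g\<close> therefore cancel.\<close>
  define w where "w = (1 / (a + b)) *\<^sub>R (y - x)"
  have mx: "m - x = a *\<^sub>R w" and my: "m - y = - (b *\<^sub>R w)" and xy: "x - y = -((a + b) *\<^sub>R w)"
  proof -
    have e: "x = (1 / (a + b)) *\<^sub>R ((a + b) *\<^sub>R x)" "y = (1 / (a + b)) *\<^sub>R ((a + b) *\<^sub>R y)"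
      using assms by auto
    show "m - x = a *\<^sub>R w"
      by (subst e(1)) (simp add: m_def w_def scaleR_diff_right[symmetric] del: scaleR_scaleR, simp add: algebra_simps)
    show "m - y = - (b *\<^sub>R w)"
      by (subst e(2)) (simp add: m_def w_def scaleR_diff_right[symmetric] del: scaleR_scaleR, simp add: algebra_simps)
    show "x - y = -((a + b) *\<^sub>R w)"
      using assms by (simp add: w_def)
  qed
  have q: "gram (g + k *\<^sub>R w) v = gram g v + 2 * k * ((g \<bullet> w) * (v \<bullet> v) - (g \<bullet> v) * (w \<bullet> v)) + k\<^sup>2 * gram w v" for k
    unfolding gram_def power2_norm_eq_inner
    by (simp add: inner_add_left inner_add_right inner_commute power2_eq_square algebra_simps)
  have 1: "gram (g + c - x) v = gram (g + a *\<^sub>R w) v"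
    using shift[of "g + (m - x)" "- ((m \<bullet> v) / (norm v)\<^sup>2)"] unfolding mx[symmetric]
    by (simp add: c_def algebra_simps)
  have 2: "gram (g + c - y) v = gram (g + (-b) *\<^sub>R w) v"
  proof -
    have my': "(-b) *\<^sub>R w = m - y" by (simp add: my)
    show ?thesis
      using shift[of "g + (m - y)" "- ((m \<bullet> v) / (norm v)\<^sup>2)"] unfolding my'
      by (simp add: c_def algebra_simps)
  qed
  have 3: "(g + c) \<bullet> v = g \<bullet> v"
    using nv by (simp add: c_def inner_add_left inner_diff_left power2_norm_eq_inner)
  have 4: "gram (x - y) v = (a + b)\<^sup>2 * gram w v"
    unfolding xy gram_minus by (simp only: gram_def norm_scaleR inner_scaleR_left power_mult_distrib power2_abs right_diff_distrib mult.assoc)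
  have 5: "gram (x - y) v / (a + b) = (a + b) * gram w v"
    unfolding 4 power2_eq_square using assms(1,2) by simp
  show ?thesis
    unfolding 1 2 3 5 q using assms(1,2) by (simp add: field_simps power2_eq_square)
qed

text \<open>The form equals \<open>s * (norm v)\<^sup>2 * (norm g)\<^sup>2 - (s - 1) * (g \<bullet>
  v)\<^sup>2\<close>, which is the anisotropic one with \<open>p = sqrt (s - 1) *\<^sub>R v\<close>;
  this is where \<open>s > 1\<close> enters.\<close>

lemma nn_integral_slab_gram:
  fixes v :: "'a::euclidean_space"
  assumes "v \<noteq> 0" "s > 1"
  shows "(\<integral>\<^sup>+g. ennreal (exp (- (pi * (s * gram g v + (g \<bullet> v)\<^sup>2)))) \<partial>lborel)
     = ennreal (s powr (-(real DIM('a) - 1)/2) / norm v ^ DIM('a))"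
proof -
  define p where "p = sqrt (s - 1) *\<^sub>R v"
  have *: "s * gram g v + (g \<bullet> v)\<^sup>2 = (s * (norm v)\<^sup>2) * (norm g)\<^sup>2 - (g \<bullet> p)\<^sup>2" for g
    using assms by (simp add: p_def gram_def power_mult_distrib algebra_simps)
  have np: "(norm p)\<^sup>2 = (s - 1) * (norm v)\<^sup>2"
    using assms by (simp add: p_def power_mult_distrib)
  have "(norm p)\<^sup>2 < s * (norm v)\<^sup>2"
    using assms by (simp add: np)
  note L = nn_integral_anisotropic_gaussian[OF this]
  have "s * (norm v)\<^sup>2 - (norm p)\<^sup>2 = (norm v)\<^sup>2"
    by (simp add: np algebra_simps)
  then have "(s * (norm v)\<^sup>2) powr (-(real DIM('a) - 1)/2) * (s * (norm v)\<^sup>2 - (norm p)\<^sup>2) powr (-1/2)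
     = s powr (-(real DIM('a) - 1)/2) * (((norm v)\<^sup>2) powr (-(real DIM('a) - 1)/2) * ((norm v)\<^sup>2) powr (-1/2))"
    using assms by (simp add: powr_mult)
  also have "((norm v)\<^sup>2) powr (-(real DIM('a) - 1)/2) * ((norm v)\<^sup>2) powr (-1/2) = ((norm v)\<^sup>2) powr (-real DIM('a)/2)"
    by (simp add: powr_add[symmetric] field_simps)
  also have "\<dots> = (norm v) powr (- real DIM('a))"
    using assms by (simp add: powr_powr powr_numeral[symmetric] del: powr_numeral)
  also have "\<dots> = 1 / norm v ^ DIM('a)"
    using assms by (simp add: powr_minus powr_realpow divide_simps)
  finally show ?thesis
    using L unfolding * by simp
qed

text \<open>Completing the square separates \<open>x - y\<close> from the integration variable, and
  \<open>a * b * (1/a + 1/b) = a + b\<close> makes the powers fit. The bound \<open>a < 1\<close>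
  ensures \<open>1/a + 1/b > 1\<close>, as \<open>nn_integral_slab_gram\<close> requires.\<close>

lemma line_kernel_semigroup:
  fixes v x y :: "'a::euclidean_space"
  assumes "0 < a" "a < 1" "0 < b" "v \<noteq> 0"
  shows "(\<integral>\<^sup>+h. ennreal (slab_weight v h * line_kernel a v (h - x) * line_kernel b v (h - y)) \<partial>lborel)
       = ennreal (line_kernel (a + b) v (x - y))"
proof -
  define m where "m = (1 / (a + b)) *\<^sub>R (b *\<^sub>R x + a *\<^sub>R y)"
  define c where "c = m - ((m \<bullet> v) / (norm v)\<^sup>2) *\<^sub>R v"
  define e where "e = -(real DIM('a) - 1)/2"
  define s where "s = 1/a + 1/b"
  have s: "s > 1"
    using assms by (simp add: s_def field_simps) (smt (verit) mult_less_cancel_right2 mult_pos_pos)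
  define K where "K = norm v ^ DIM('a) * (a powr e * b powr e * exp (- (pi * (gram (x - y) v / (a + b)))))"
  have K: "K \<ge> 0" by (simp add: K_def)
  have "(\<integral>\<^sup>+h. ennreal (slab_weight v h * line_kernel a v (h - x) * line_kernel b v (h - y)) \<partial>lborel)
     = (\<integral>\<^sup>+g. ennreal (slab_weight v (g + c) * line_kernel a v (g + c - x) * line_kernel b v (g + c - y)) \<partial>lborel)"
    by (rule nn_integral_lborel_translation[symmetric]) measurable
  also have "\<dots> = (\<integral>\<^sup>+g. ennreal K * ennreal (exp (- (pi * (s * gram g v + (g \<bullet> v)\<^sup>2)))) \<partial>lborel)"
  proof (intro nn_integral_cong)
    fix g
    have "slab_weight v (g + c) * line_kernel a v (g + c - x) * line_kernel b v (g + c - y)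
       = norm v ^ DIM('a) * (a powr e * b powr e *
          exp (- (pi * (gram (g + c - x) v / a + gram (g + c - y) v / b + ((g + c) \<bullet> v)\<^sup>2))))"
      by (simp add: slab_weight_def line_kernel_def e_def distrib_left exp_add[symmetric] exp_diff exp_minus divide_simps)
         (simp add: exp_add algebra_simps)
    also have "gram (g + c - x) v / a + gram (g + c - y) v / b + ((g + c) \<bullet> v)\<^sup>2
        = (s * gram g v + (g \<bullet> v)\<^sup>2) + gram (x - y) v / (a + b)"
      unfolding c_def m_def s_def using gram_complete_square[OF assms(1,3,4)] by simp
    also have "exp (- (pi * ((s * gram g v + (g \<bullet> v)\<^sup>2) + gram (x - y) v / (a + b))))
       = exp (- (pi * (gram (x - y) v / (a + b)))) * exp (- (pi * (s * gram g v + (g \<bullet> v)\<^sup>2)))"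
      unfolding exp_add[symmetric] by (simp only: distrib_left minus_add_distrib add.commute)
    also have "norm v ^ DIM('a) * (a powr e * b powr e * (exp (- (pi * (gram (x - y) v / (a + b)))) * exp (- (pi * (s * gram g v + (g \<bullet> v)\<^sup>2)))))
       = K * exp (- (pi * (s * gram g v + (g \<bullet> v)\<^sup>2)))"
      by (simp add: K_def)
    finally show "ennreal (slab_weight v (g + c) * line_kernel a v (g + c - x) * line_kernel b v (g + c - y))
      = ennreal K * ennreal (exp (- (pi * (s * gram g v + (g \<bullet> v)\<^sup>2))))"
      using K by (simp add: ennreal_mult)
  qed
  also have "\<dots> = ennreal K * ennreal (s powr e / norm v ^ DIM('a))"
    using nn_integral_slab_gram[OF assms(4) s] by (simp add: nn_integral_cmult e_def)
  also have "\<dots> = ennreal (K * (s powr e / norm v ^ DIM('a)))"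
    using K by (intro ennreal_mult[symmetric]) auto
  also have "K * (s powr e / norm v ^ DIM('a)) = (a powr e * b powr e * s powr e) * exp (- (pi * (gram (x - y) v / (a + b))))"
    using assms by (simp add: K_def)
  also have "a powr e * b powr e * s powr e = (a + b) powr e"
  proof -
    have "a * b * s = a + b" using assms by (simp add: s_def field_simps)
    then show ?thesis using assms s by (simp add: powr_mult[symmetric])
  qed
  finally show ?thesis
    by (simp add: line_kernel_def e_def)
qed

text \<open>As a function of \<open>v\<close> the exponent is again an anisotropic quadratic form,
  now with eigenvalue 1 along \<open>u\<close> and \<open>1 + (norm u)\<^sup>2 / A\<close> across
  it.\<close>

lemma line_kernel_gauss_integral:
  fixes u :: "'a::euclidean_space"
  assumes "A > 0"
  shows "(\<integral>\<^sup>+v. ennreal (gauss_weight v * line_kernel A v u) \<partial>lborel)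
     = ennreal ((A + (norm u)\<^sup>2) powr (-(real DIM('a) - 1)/2))"
proof -
  define e where "e = -(real DIM('a) - 1)/2"
  define p where "p = (1 / sqrt A) *\<^sub>R u"
  define l where "l = 1 + (norm u)\<^sup>2 / A"
  have np: "(norm p)\<^sup>2 = (norm u)\<^sup>2 / A"
    using assms by (simp add: p_def power_divide)
  have lp: "(norm p)\<^sup>2 < l" "l - (norm p)\<^sup>2 = 1"
    by (auto simp: np l_def)
  have "gauss_weight v * line_kernel A v u = A powr e * exp (- (pi * (l * (norm v)\<^sup>2 - (v \<bullet> p)\<^sup>2)))" for v
  proof -
    have "l * (norm v)\<^sup>2 - (v \<bullet> p)\<^sup>2 = (norm v)\<^sup>2 + gram u v / A"
      using assms by (simp add: l_def p_def gram_def power_divide power_mult_distrib inner_commute field_simps)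
    then show ?thesis
      by (simp add: gauss_weight_def line_kernel_def e_def exp_add[symmetric] algebra_simps)
  qed
  then have "(\<integral>\<^sup>+v. ennreal (gauss_weight v * line_kernel A v u) \<partial>lborel)
      = (\<integral>\<^sup>+v. ennreal (A powr e) * ennreal (exp (- (pi * (l * (norm v)\<^sup>2 - (v \<bullet> p)\<^sup>2)))) \<partial>lborel)"
    by (simp add: ennreal_mult)
  also have "\<dots> = ennreal (A powr e) * ennreal (l powr e)"
    using nn_integral_anisotropic_gaussian[OF lp(1)] lp(2) by (simp add: nn_integral_cmult e_def)
  also have "\<dots> = ennreal ((A * l) powr e)"
    using assms by (simp add: ennreal_mult[symmetric] powr_mult l_def)
  also have "A * l = A + (norm u)\<^sup>2"
    using assms by (simp add: l_def field_simps)
  finally show ?thesis by (simp add: e_def)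
qed

text \<open>A pair \<open>(v, h)\<close> stands for the line through \<open>h\<close> with direction
  \<open>v\<close>. Integration over all lines leaves a kernel in the distance of \<open>x\<close>
  and \<open>y\<close> alone, which makes L^2 norms over the space of lines computable.\<close>

lemma line_kernel_pairing:
  fixes x y :: "'a::euclidean_space"
  assumes "0 < a" "a < 1" "0 < b"
  shows "(\<integral>\<^sup>+v. (\<integral>\<^sup>+h. ennreal (gauss_weight v * slab_weight v h * line_kernel a v (h - x) * line_kernel b v (h - y)) \<partial>lborel) \<partial>lborel)
       = ennreal ((a + b + (norm (x - y))\<^sup>2) powr (-(real DIM('a) - 1)/2))"
proof -
  have "(\<integral>\<^sup>+v. (\<integral>\<^sup>+h. ennreal (gauss_weight v * slab_weight v h * line_kernel a v (h - x) * line_kernel b v (h - y)) \<partial>lborel) \<partial>lborel)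
     = (\<integral>\<^sup>+v. ennreal (gauss_weight v * line_kernel (a + b) v (x - y)) \<partial>lborel)"
  proof (rule nn_integral_cong_AE)
    have "AE v in lborel. v \<noteq> (0::'a)" by (rule AE_lborel_singleton)
    then show "AE v in lborel. (\<integral>\<^sup>+h. ennreal (gauss_weight v * slab_weight v h * line_kernel a v (h - x) * line_kernel b v (h - y)) \<partial>lborel)
        = ennreal (gauss_weight v * line_kernel (a + b) v (x - y))"
    proof eventually_elim
      case (elim v)
      have "(\<integral>\<^sup>+h. ennreal (gauss_weight v * slab_weight v h * line_kernel a v (h - x) * line_kernel b v (h - y)) \<partial>lborel)
        = (\<integral>\<^sup>+h. ennreal (gauss_weight v) * ennreal (slab_weight v h * line_kernel a v (h - x) * line_kernel b v (h - y)) \<partial>lborel)"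
        by (simp add: ennreal_mult[symmetric] mult.assoc)
      then show ?case
        using line_kernel_semigroup[OF assms elim, of x y]
        by (simp add: nn_integral_cmult ennreal_mult)
    qed
  qed
  also have "\<dots> = ennreal ((a + b + (norm (x - y))\<^sup>2) powr (-(real DIM('a) - 1)/2))"
    using assms by (intro line_kernel_gauss_integral) simp
  finally show ?thesis .
qed

subsection \<open>Smoothing a measure along lines\<close>

text \<open>Only one order of cancellation is needed because \<open>s \<le> m + 2\<close>: the third term is absorbed by
  monotonicity and the remaining first difference is estimated by the mean value theorem.\<close>

lemma powr_second_difference:
  fixes \<alpha> \<rho> m s :: real
  assumes "\<alpha> > 0" "\<rho> > 0" "m \<ge> 0" "0 \<le> s" "s \<le> m + 2"
  shows "(\<alpha>/4 + \<rho>\<^sup>2) powr (-m/2) + (7*\<alpha>/4 + \<rho>\<^sup>2) powr (-m/2)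
     \<le> 2 * (\<alpha> + \<rho>\<^sup>2) powr (-m/2) + (m * 4 powr ((m + 2 - s)/2)) * \<alpha> powr ((s - m)/2) * \<rho> powr (- s)"
proof -
  define X where "X = \<alpha>/4 + \<rho>\<^sup>2"
  define Y where "Y = \<alpha> + \<rho>\<^sup>2"
  have X: "X > 0" "X < Y" "Y - X = 3/4 * \<alpha>"
    using assms by (auto simp: X_def Y_def intro: add_pos_nonneg)
  have "\<exists>z>X. z < Y \<and> Y powr (-m/2) - X powr (-m/2) = (Y - X) * ((-m/2) * z powr (-m/2 - 1))"
    using X by (intro MVT2) (auto intro!: derivative_eq_intros)
  then obtain z where z: "z > X" "Y powr (-m/2) - X powr (-m/2) = (Y - X) * ((-m/2) * z powr (-m/2 - 1))"
    by blast
  have "X powr (-m/2) - Y powr (-m/2) = (3/8 * \<alpha> * m) * z powr (-m/2 - 1)"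
    using z(2) X(3) by simp
  also have "\<dots> \<le> (3/8 * \<alpha> * m) * X powr (-m/2 - 1)"
    using z X assms by (intro mult_left_mono powr_mono2') auto
  also have "\<dots> \<le> (\<alpha> * m) * X powr (-m/2 - 1)"
    using assms by (intro mult_right_mono) auto
  \<comment> \<open>The exponent is split so that one factor is bounded through
    \<open>X \<ge> \<alpha>/4\<close> and the other through \<open>X \<ge> \<rho>\<^sup>2\<close>;
    both exponents are nonpositive because \<open>0 \<le> s \<le> m + 2\<close>.\<close>
  also have "X powr (-m/2 - 1) = X powr (-(m+2-s)/2) * X powr (-s/2)"
  proof -
    have "-m/2 - 1 = -(m+2-s)/2 + -s/2" by (simp add: field_simps)
    then show ?thesis by (simp only: powr_add)
  qed
  also have "\<dots> \<le> (\<alpha>/4) powr (-(m+2-s)/2) * (\<rho>\<^sup>2) powr (-s/2)"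
    using assms by (intro mult_mono powr_mono2') (auto simp: X_def)
  also have "(\<rho>\<^sup>2) powr (-s/2) = \<rho> powr (- s)"
    using assms by (simp add: powr_powr powr_numeral[symmetric] del: powr_numeral)
  also have "(\<alpha>/4) powr (-(m+2-s)/2) = 4 powr ((m+2-s)/2) * \<alpha> powr (-(m+2-s)/2)"
  proof -
    have "(\<alpha>/4) powr (-E) = 4 powr E * \<alpha> powr (-E)" for E
      using assms by (simp add: powr_divide powr_minus divide_simps)
    from this[of "(m+2-s)/2"] show ?thesis by (simp only: minus_divide_left)
  qed
  also have "(\<alpha> * m) * (4 powr ((m+2-s)/2) * \<alpha> powr (-(m+2-s)/2) * \<rho> powr (- s))
      = (m * 4 powr ((m+2-s)/2)) * (\<alpha> powr 1 * \<alpha> powr (-(m+2-s)/2)) * \<rho> powr (- s)"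
    using assms by simp
  also have "\<alpha> powr 1 * \<alpha> powr (-(m+2-s)/2) = \<alpha> powr ((s - m)/2)"
  proof -
    have "1 + -(m+2-s)/2 = (s - m)/2" by (simp add: field_simps)
    then show ?thesis by (simp only: powr_add[symmetric])
  qed
  finally have *: "X powr (-m/2) - Y powr (-m/2) \<le> (m * 4 powr ((m + 2 - s)/2)) * \<alpha> powr ((s - m)/2) * \<rho> powr (- s)"
    using assms by (simp add: mult_left_mono)
  have "(7*\<alpha>/4 + \<rho>\<^sup>2) powr (-m/2) \<le> Y powr (-m/2)"
    using assms X by (intro powr_mono2') (auto simp: Y_def)
  with * show ?thesis
    unfolding X_def Y_def by linarith
qed

locale finite_euclidean_measure = finite_measure \<mu> for \<mu> :: "'a::euclidean_space measure" +
  assumes sets_eq [measurable_cong]: "sets \<mu> = sets borel"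
begin

text \<open>The average called \<open>F a h v\<close> in the introduction. It is real-valued because
  its values at different scales are subtracted later.\<close>

definition smoothing :: "real \<Rightarrow> 'a \<Rightarrow> 'a \<Rightarrow> real" where
  "smoothing a v h = (LINT y|\<mu>. line_kernel a v (h - y))"

lemma integrable_line_kernel: "a > 0 \<Longrightarrow> integrable \<mu> (\<lambda>y. line_kernel a v (h - y))"
  by (rule integrable_const_bound[where B = "a powr (-(real DIM('a) - 1)/2)"], intro AE_I2)
     (simp_all only: real_norm_def abs_of_nonneg[OF line_kernel_nonneg] line_kernel_le, measurable)

lemma smoothing_nonneg [simp]: "smoothing a v h \<ge> 0"
  unfolding smoothing_def by simp

lemma ennreal_smoothing:
  "a > 0 \<Longrightarrow> ennreal (smoothing a v h) = (\<integral>\<^sup>+y. ennreal (line_kernel a v (h - y)) \<partial>\<mu>)"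
  unfolding smoothing_def by (simp add: nn_integral_eq_integral integrable_line_kernel)

lemma smoothing_le:
  assumes "a > 0"
  shows "smoothing a v h \<le> a powr (-(real DIM('a) - 1)/2) * measure \<mu> (space \<mu>)"
proof -
  have "smoothing a v h \<le> (LINT y|\<mu>. a powr (-(real DIM('a) - 1)/2))"
    unfolding smoothing_def
    by (intro integral_mono integrable_line_kernel assms line_kernel_le) auto
  then show ?thesis by (simp add: mult.commute)
qed

lemma smoothing_measurable [measurable (raw)]:
  assumes [measurable]: "f \<in> borel_measurable M" "g \<in> borel_measurable M"
  shows "(\<lambda>x. smoothing a (f x) (g x)) \<in> borel_measurable M"
  unfolding smoothing_def by measurable

lemma smoothing_semigroup:
  assumes "0 < c" "c < 1" "0 < b" "v \<noteq> 0"
  shows "ennreal (smoothing (c + b) v x)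
     = (\<integral>\<^sup>+h. ennreal (slab_weight v h * line_kernel c v (h - x)) * ennreal (smoothing b v h) \<partial>lborel)"
proof -
  interpret P: pair_sigma_finite lborel \<mu> ..
  have "ennreal (smoothing (c + b) v x) = (\<integral>\<^sup>+y. ennreal (line_kernel (c + b) v (x - y)) \<partial>\<mu>)"
    using assms by (simp add: ennreal_smoothing)
  also have "\<dots> = (\<integral>\<^sup>+y. (\<integral>\<^sup>+h. ennreal (slab_weight v h * line_kernel c v (h - x)) * ennreal (line_kernel b v (h - y)) \<partial>lborel) \<partial>\<mu>)"
    using assms by (simp add: line_kernel_semigroup[symmetric] ennreal_mult[symmetric])
  also have "\<dots> = (\<integral>\<^sup>+h. (\<integral>\<^sup>+y. ennreal (slab_weight v h * line_kernel c v (h - x)) * ennreal (line_kernel b v (h - y)) \<partial>\<mu>) \<partial>lborel)"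
    by (rule P.Fubini') measurable
  also have "\<dots> = (\<integral>\<^sup>+h. ennreal (slab_weight v h * line_kernel c v (h - x)) * ennreal (smoothing b v h) \<partial>lborel)"
    using assms by (simp add: nn_integral_cmult ennreal_smoothing)
  finally show ?thesis .
qed

text \<open>The semigroup property transports a difference at scales \<open>a\<close> and
  \<open>b\<close> to scales \<open>c + a\<close> and \<open>c + b\<close>. To avoid subtraction in
  \<open>ennreal\<close>, each smoothing is bounded by the other plus the integrated difference, and
  the two bounds are combined.\<close>

lemma smoothing_difference_le:
  assumes "0 < c" "c < 1" "0 < a" "0 < b" "v \<noteq> 0"
  shows "ennreal \<bar>smoothing (c + a) v x - smoothing (c + b) v x\<bar>
     \<le> (\<integral>\<^sup>+h. ennreal (slab_weight v h * line_kernel c v (h - x)) * ennreal \<bar>smoothing a v h - smoothing b v h\<bar> \<partial>lborel)"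
proof -
  let ?I = "\<integral>\<^sup>+h. ennreal (slab_weight v h * line_kernel c v (h - x)) * ennreal \<bar>smoothing a v h - smoothing b v h\<bar> \<partial>lborel"
  have main: "ennreal (smoothing (c + a) v x) \<le> ennreal (smoothing (c + b) v x) +
      (\<integral>\<^sup>+h. ennreal (slab_weight v h * line_kernel c v (h - x)) * ennreal \<bar>smoothing a v h - smoothing b v h\<bar> \<partial>lborel)"
    if "0 < a" "0 < b" for a b
  proof -
    have "ennreal (smoothing (c + a) v x) \<le>
      (\<integral>\<^sup>+h. ennreal (slab_weight v h * line_kernel c v (h - x)) * ennreal (smoothing b v h)
         + ennreal (slab_weight v h * line_kernel c v (h - x)) * ennreal \<bar>smoothing a v h - smoothing b v h\<bar> \<partial>lborel)"
      unfolding smoothing_semigroup[OF assms(1,2) that(1) assms(5)]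
    proof (rule nn_integral_mono)
      fix h
      have "ennreal (smoothing a v h) \<le> ennreal (smoothing b v h) + ennreal \<bar>smoothing a v h - smoothing b v h\<bar>"
        by (simp add: ennreal_plus[symmetric] del: ennreal_plus)
      from mult_left_mono[OF this]
      show "ennreal (slab_weight v h * line_kernel c v (h - x)) * ennreal (smoothing a v h)
         \<le> ennreal (slab_weight v h * line_kernel c v (h - x)) * ennreal (smoothing b v h)
         + ennreal (slab_weight v h * line_kernel c v (h - x)) * ennreal \<bar>smoothing a v h - smoothing b v h\<bar>"
        by (simp add: distrib_left)
    qed
    also have "\<dots> = ennreal (smoothing (c + b) v x) + (\<integral>\<^sup>+h. ennreal (slab_weight v h * line_kernel c v (h - x)) * ennreal \<bar>smoothing a v h - smoothing b v h\<bar> \<partial>lborel)"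
      unfolding smoothing_semigroup[OF assms(1,2) that(2) assms(5)]
      by (rule nn_integral_add) measurable
    finally show ?thesis .
  qed
  show ?thesis
  proof (cases ?I rule: ennreal_cases)
    case i: (real i)
    have "ennreal (smoothing (c + a) v x) \<le> ennreal (smoothing (c + b) v x + i)"
      using main[OF assms(3,4)] i(1) unfolding i(2) by (simp only: ennreal_plus smoothing_nonneg)
    then have "smoothing (c + a) v x \<le> smoothing (c + b) v x + i"
      by (rule ennreal_le_iff[THEN iffD1, rotated]) (simp add: i(1))
    moreover have "ennreal (smoothing (c + b) v x) \<le> ennreal (smoothing (c + a) v x + i)"
      using main[OF assms(4,3)] i(1) unfolding abs_minus_commute[of "smoothing b _ _"] i(2)
      by (simp only: ennreal_plus smoothing_nonneg)
    then have "smoothing (c + b) v x \<le> smoothing (c + a) v x + i"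
      by (rule ennreal_le_iff[THEN iffD1, rotated]) (simp add: i(1))
    ultimately show ?thesis
      unfolding i(2) by (intro ennreal_leI) linarith
  qed simp
qed

text \<open>A product of two smoothings is a double integral of kernels against
  \<open>\<mu>\<close>; Tonelli brings the integration over lines inside, where
  \<open>line_kernel_pairing\<close> evaluates it.\<close>

lemma smoothing_pairing:
  assumes "0 < a" "a < 1" "0 < b"
  shows "(\<integral>\<^sup>+p. ennreal (gauss_weight (fst p) * slab_weight (fst p) (snd p) * smoothing a (fst p) (snd p) * smoothing b (fst p) (snd p)) \<partial>(lborel \<Otimes>\<^sub>M lborel))
    = (\<integral>\<^sup>+x. (\<integral>\<^sup>+y. ennreal ((a + b + (norm (x - y))\<^sup>2) powr (-(real DIM('a) - 1)/2)) \<partial>\<mu>) \<partial>\<mu>)"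
proof -
  let ?L = "lborel \<Otimes>\<^sub>M lborel :: ('a \<times> 'a) measure"
  interpret PL: pair_sigma_finite "lborel :: 'a measure" "lborel :: 'a measure" ..
  interpret PM: pair_sigma_finite \<mu> \<mu> ..
  interpret P: pair_sigma_finite "lborel \<Otimes>\<^sub>M lborel :: ('a \<times> 'a) measure" "\<mu> \<Otimes>\<^sub>M \<mu>" ..
  define G :: "('a \<times> 'a) \<times> 'a \<times> 'a \<Rightarrow> ennreal" where "G = (\<lambda>z. ennreal (gauss_weight (fst (fst z)) * slab_weight (fst (fst z)) (snd (fst z)) * line_kernel a (fst (fst z)) (snd (fst z) - fst (snd z)) * line_kernel b (fst (fst z)) (snd (fst z) - snd (snd z))))"
  have G [measurable]: "G \<in> borel_measurable (?L \<Otimes>\<^sub>M (\<mu> \<Otimes>\<^sub>M \<mu>))"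
    unfolding G_def by measurable
  have "(\<integral>\<^sup>+p. ennreal (gauss_weight (fst p) * slab_weight (fst p) (snd p) * smoothing a (fst p) (snd p) * smoothing b (fst p) (snd p)) \<partial>?L)
     = (\<integral>\<^sup>+p. (\<integral>\<^sup>+q. G (p, q) \<partial>(\<mu> \<Otimes>\<^sub>M \<mu>)) \<partial>?L)"
  proof (rule nn_integral_cong)
    fix p :: "'a \<times> 'a"
    define k where "k = gauss_weight (fst p) * slab_weight (fst p) (snd p)"
    have k: "k \<ge> 0" by (simp add: k_def)
    have "(\<integral>\<^sup>+q. G (p, q) \<partial>(\<mu> \<Otimes>\<^sub>M \<mu>)) = (\<integral>\<^sup>+x. (\<integral>\<^sup>+y. G (p, x, y) \<partial>\<mu>) \<partial>\<mu>)"
      by (subst nn_integral_fst[symmetric]) (auto simp: G_def)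
    also have "\<dots> = (\<integral>\<^sup>+x. (\<integral>\<^sup>+y. ennreal k * (ennreal (line_kernel a (fst p) (snd p - x)) * ennreal (line_kernel b (fst p) (snd p - y))) \<partial>\<mu>) \<partial>\<mu>)"
      by (simp add: G_def k_def ennreal_mult mult.assoc)
    also have "\<dots> = ennreal k * (ennreal (smoothing a (fst p) (snd p)) * ennreal (smoothing b (fst p) (snd p)))"
      using assms by (simp add: nn_integral_cmult nn_integral_multc ennreal_smoothing)
    also have "\<dots> = ennreal (k * smoothing a (fst p) (snd p) * smoothing b (fst p) (snd p))"
      using k by (simp add: ennreal_mult[symmetric] mult.assoc)
    finally show "ennreal (gauss_weight (fst p) * slab_weight (fst p) (snd p) * smoothing a (fst p) (snd p) * smoothing b (fst p) (snd p)) = (\<integral>\<^sup>+q. G (p, q) \<partial>(\<mu> \<Otimes>\<^sub>M \<mu>))"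
      by (simp add: k_def)
  qed
  also have "\<dots> = (\<integral>\<^sup>+q. (\<integral>\<^sup>+p. G (p, q) \<partial>?L) \<partial>(\<mu> \<Otimes>\<^sub>M \<mu>))"
    by (rule P.Fubini'[symmetric]) simp
  also have "\<dots> = (\<integral>\<^sup>+q. ennreal ((a + b + (norm (fst q - snd q))\<^sup>2) powr (-(real DIM('a) - 1)/2)) \<partial>(\<mu> \<Otimes>\<^sub>M \<mu>))"
  proof (rule nn_integral_cong)
    fix q :: "'a \<times> 'a"
    have "(\<integral>\<^sup>+p. G (p, q) \<partial>?L) = (\<integral>\<^sup>+v. (\<integral>\<^sup>+h. G ((v, h), q) \<partial>lborel) \<partial>lborel)"
      by (subst lborel.nn_integral_fst[symmetric]) (auto simp: G_def)
    then show "(\<integral>\<^sup>+p. G (p, q) \<partial>?L) = ennreal ((a + b + (norm (fst q - snd q))\<^sup>2) powr (-(real DIM('a) - 1)/2))"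
      using line_kernel_pairing[OF assms] by (simp add: G_def)
  qed
  also have "\<dots> = (\<integral>\<^sup>+x. (\<integral>\<^sup>+y. ennreal ((a + b + (norm (x - y))\<^sup>2) powr (-(real DIM('a) - 1)/2)) \<partial>\<mu>) \<partial>\<mu>)"
    by (subst nn_integral_fst[symmetric]) auto
  finally show ?thesis .
qed

text \<open>Expanding the square gives pairings at the equally spaced parameters
  \<open>\<alpha>/4\<close>, \<open>\<alpha>\<close> and \<open>7*\<alpha>/4\<close>, hence a second
  difference of the radial kernel, which \<open>powr_second_difference\<close> bounds by the Riesz
  kernel. The scales \<open>\<alpha>/8\<close> and \<open>7*\<alpha>/8\<close> are those that become
  \<open>\<alpha>/4\<close> and \<open>\<alpha>\<close> after adding \<open>\<alpha>/8\<close>, as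
  \<open>oscillation\<close> will need.\<close>

lemma smoothing_difference_L2:
  assumes "0 < \<alpha>" "\<alpha> \<le> 1" "0 \<le> s" "s \<le> real DIM('a) + 1"
  shows "(\<integral>\<^sup>+p. ennreal (gauss_weight (fst p) * slab_weight (fst p) (snd p) * (smoothing (\<alpha>/8) (fst p) (snd p) - smoothing (7*\<alpha>/8) (fst p) (snd p))\<^sup>2) \<partial>(lborel \<Otimes>\<^sub>M lborel))
    \<le> ennreal ((real DIM('a) - 1) * 4 powr ((real DIM('a) + 1 - s)/2) * \<alpha> powr ((s - (real DIM('a) - 1))/2)) * energy s \<mu>"
proof -
  let ?L = "lborel \<Otimes>\<^sub>M lborel :: ('a \<times> 'a) measure"
  define m where "m = real DIM('a) - 1"
  have m: "m \<ge> 0" unfolding m_def using DIM_positive[where 'a='a] by linarith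
  define K where "K = m * 4 powr ((m + 2 - s)/2) * \<alpha> powr ((s - m)/2)"
  define W where "W = (\<lambda>p::'a \<times> 'a. gauss_weight (fst p) * slab_weight (fst p) (snd p))"
  define A where "A = (\<lambda>p. smoothing (\<alpha>/8) (fst p) (snd p))"
  define B where "B = (\<lambda>p. smoothing (7*\<alpha>/8) (fst p) (snd p))"
  have [measurable]: "W \<in> borel_measurable ?L" "A \<in> borel_measurable ?L" "B \<in> borel_measurable ?L"
    unfolding W_def A_def B_def by measurable
  have nn: "W p \<ge> 0" "A p \<ge> 0" "B p \<ge> 0" for p
    by (auto simp: W_def A_def B_def)
  define E where "E = (\<lambda>c. \<integral>\<^sup>+x. (\<integral>\<^sup>+y. ennreal ((c + (norm (x - y))\<^sup>2) powr (-m/2)) \<partial>\<mu>) \<partial>\<mu>)"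
  have sums: "\<alpha>/8 + \<alpha>/8 = \<alpha>/4" "\<alpha>/8 + 7*\<alpha>/8 = \<alpha>" "7*\<alpha>/8 + 7*\<alpha>/8 = 7*\<alpha>/4"
    by simp_all
  have pos: "0 < \<alpha>/8" "\<alpha>/8 < 1" "0 < 7*\<alpha>/8" "7*\<alpha>/8 < 1"
    using assms by simp_all
  have AA: "(\<integral>\<^sup>+p. ennreal (W p * A p * A p) \<partial>?L) = E (\<alpha>/4)"
    unfolding W_def A_def E_def m_def using smoothing_pairing[OF pos(1,2,1)] unfolding sums .
  have AB: "(\<integral>\<^sup>+p. ennreal (W p * A p * B p) \<partial>?L) = E \<alpha>"
    unfolding W_def A_def B_def E_def m_def using smoothing_pairing[OF pos(1,2,3)] unfolding sums .
  have BB: "(\<integral>\<^sup>+p. ennreal (W p * B p * B p) \<partial>?L) = E (7*\<alpha>/4)"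
    unfolding W_def B_def E_def m_def using smoothing_pairing[OF pos(3,4,3)] unfolding sums .
  let ?D = "\<integral>\<^sup>+p. ennreal (W p * (A p - B p)\<^sup>2) \<partial>?L"
  \<comment> \<open>The mixed term is added on both sides instead of subtracted. It is cancelled at
    the end, being finite: for \<open>\<alpha> > 0\<close> the kernel is bounded, and
    \<open>\<mu>\<close> is finite.\<close>
  have "?D + 2 * E \<alpha> = (\<integral>\<^sup>+p. ennreal (W p * (A p - B p)\<^sup>2) + 2 * ennreal (W p * A p * B p) \<partial>?L)"
    unfolding AB[symmetric] by (subst nn_integral_add) (auto simp: nn_integral_cmult)
  also have "\<dots> = (\<integral>\<^sup>+p. ennreal (W p * A p * A p) + ennreal (W p * B p * B p) \<partial>?L)"
  proof (rule nn_integral_cong)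
    fix p
    have "ennreal (W p * (A p - B p)\<^sup>2) + 2 * ennreal (W p * A p * B p)
        = ennreal (W p * (A p - B p)\<^sup>2 + 2 * (W p * A p * B p))"
      using nn[of p] by (simp add: ennreal_mult'')
    also have "W p * (A p - B p)\<^sup>2 + 2 * (W p * A p * B p) = W p * A p * A p + W p * B p * B p"
      by (simp add: power2_eq_square algebra_simps)
    finally show "ennreal (W p * (A p - B p)\<^sup>2) + 2 * ennreal (W p * A p * B p)
       = ennreal (W p * A p * A p) + ennreal (W p * B p * B p)"
      using nn[of p] by simp
  qed
  also have "\<dots> = E (\<alpha>/4) + E (7*\<alpha>/4)"
    unfolding AA[symmetric] BB[symmetric] by (rule nn_integral_add) auto
  also have "\<dots> = (\<integral>\<^sup>+x. (\<integral>\<^sup>+y. ennreal ((\<alpha>/4 + (norm (x - y))\<^sup>2) powr (-m/2)) + ennreal ((7*\<alpha>/4 + (norm (x - y))\<^sup>2) powr (-m/2)) \<partial>\<mu>) \<partial>\<mu>)"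
    unfolding E_def by (simp add: nn_integral_add)
  also have "\<dots> \<le> (\<integral>\<^sup>+x. (\<integral>\<^sup>+y. 2 * ennreal ((\<alpha> + (norm (x - y))\<^sup>2) powr (-m/2)) + ennreal K * riesz_kernel s x y \<partial>\<mu>) \<partial>\<mu>)"
  proof (intro nn_integral_mono)
    fix x y :: 'a
    show "ennreal ((\<alpha>/4 + (norm (x - y))\<^sup>2) powr (-m/2)) + ennreal ((7*\<alpha>/4 + (norm (x - y))\<^sup>2) powr (-m/2))
      \<le> 2 * ennreal ((\<alpha> + (norm (x - y))\<^sup>2) powr (-m/2)) + ennreal K * riesz_kernel s x y"
    \<comment> \<open>On the diagonal the Riesz kernel is infinite, which settles the bound unless
      \<open>K = 0\<close>. If \<open>K = 0\<close> there, then \<open>m = 0\<close>, all powers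
      have exponent 0 and both sides equal 2.\<close>
    proof (cases "x = y \<and> K \<noteq> 0")
      case True
      have "K > 0" using True m unfolding K_def by (simp add: less_le)
      then show ?thesis using True by (simp add: riesz_kernel_def ennreal_mult_top)
    next
      case False
      show ?thesis
      proof (cases "x = y")
        case True
        then have "m = 0" using False assms by (auto simp: K_def)
        then show ?thesis using assms True by (simp add: ennreal_plus[symmetric] del: ennreal_plus)
      next
        case F: False
        have "K \<ge> 0" using m by (simp add: K_def)
        have "(\<alpha>/4 + (norm (x - y))\<^sup>2) powr (-m/2) + (7*\<alpha>/4 + (norm (x - y))\<^sup>2) powr (-m/2)
           \<le> 2 * (\<alpha> + (norm (x - y))\<^sup>2) powr (-m/2) + K * dist x y powr (- s)"
          using powr_second_difference[of \<alpha> "norm (x - y)" m s] assms m F by (simp add: K_def m_def dist_norm)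
        then have "ennreal ((\<alpha>/4 + (norm (x - y))\<^sup>2) powr (-m/2) + (7*\<alpha>/4 + (norm (x - y))\<^sup>2) powr (-m/2))
           \<le> ennreal (2 * (\<alpha> + (norm (x - y))\<^sup>2) powr (-m/2) + K * dist x y powr (- s))"
          by (rule ennreal_leI)
        then show ?thesis
          using F \<open>K \<ge> 0\<close> by (simp add: riesz_kernel_def ennreal_mult ennreal_mult'')
      qed
    qed
  qed
  also have "\<dots> = 2 * E \<alpha> + ennreal K * energy s \<mu>"
  proof -
    have [measurable]: "(\<lambda>z. riesz_kernel s (fst z) (snd z)) \<in> borel_measurable (\<mu> \<Otimes>\<^sub>M \<mu>)"
      unfolding riesz_kernel_def by measurable
    have [measurable]: "(\<lambda>y. riesz_kernel s x y) \<in> borel_measurable \<mu>" for x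
      unfolding riesz_kernel_def by measurable
    have [measurable]: "(\<lambda>x. \<integral>\<^sup>+y. riesz_kernel s x y \<partial>\<mu>) \<in> borel_measurable \<mu>"
      using borel_measurable_nn_integral_fst[of "\<lambda>z. riesz_kernel s (fst z) (snd z)" \<mu>] by simp
    show ?thesis
      unfolding E_def energy_def by (simp add: nn_integral_add nn_integral_cmult)
  qed
  finally have *: "?D + 2 * E \<alpha> \<le> 2 * E \<alpha> + ennreal K * energy s \<mu>" .
  have "E \<alpha> \<le> (\<integral>\<^sup>+x. (\<integral>\<^sup>+y. ennreal (\<alpha> powr (-m/2)) \<partial>\<mu>) \<partial>\<mu>)"
    unfolding E_def using assms m by (intro nn_integral_mono ennreal_leI powr_mono2') auto
  also have "\<dots> < \<infinity>"
    by (simp add: ennreal_mult_eq_top_iff less_top[symmetric])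
  finally have "2 * E \<alpha> < \<infinity>" by (simp add: ennreal_mult_less_top)
  with * have "?D \<le> ennreal K * energy s \<mu>"
    by (auto simp: add.commute[of ?D] ennreal_add_left_cancel_le)
  then show ?thesis
    by (simp add: W_def A_def B_def K_def m_def add.commute)
qed

end

subsection \<open>Hausdorff content and finite Frostman weights\<close>

lemma hausdorff_pre_mono: "A \<subseteq> B \<Longrightarrow> hausdorff_pre s \<delta> A \<le> hausdorff_pre s \<delta> B"
  unfolding hausdorff_pre_def by (rule INF_superset_mono) auto

lemma hausdorff_pre_le_measure: "\<delta> > 0 \<Longrightarrow> hausdorff_pre s \<delta> A \<le> hausdorff_measure s A"
  unfolding hausdorff_measure_def by (rule SUP_upper) simp

text \<open>Subadditivity is proved at a fixed mesh size because the exceptional set is later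
  decomposed with \<open>\<delta>\<close> held fixed.\<close>

lemma hausdorff_pre_UN_le:
  fixes A :: "nat \<Rightarrow> 'a::metric_space set"
  shows "hausdorff_pre s \<delta> (\<Union>i. A i) \<le> (\<Sum>i. hausdorff_pre s \<delta> (A i))"
proof (rule ennreal_le_epsilon)
  fix e :: real
  assume fin: "(\<Sum>i. hausdorff_pre s \<delta> (A i)) < top" and e: "0 < e"
  define \<epsilon> where "\<epsilon> = (\<lambda>i::nat. e * (1/2) ^ Suc i)"
  have "\<exists>C. A i \<subseteq> (\<Union>j. C j) \<and> (\<forall>j. bounded (C j) \<and> diameter (C j) \<le> \<delta>) \<and>
      (\<Sum>j. ennreal (diameter (C j) powr s)) \<le> hausdorff_pre s \<delta> (A i) + ennreal (\<epsilon> i)" for i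
  proof -
    have "hausdorff_pre s \<delta> (A i) < hausdorff_pre s \<delta> (A i) + ennreal (\<epsilon> i)"
    proof -
      have "hausdorff_pre s \<delta> (A i) \<noteq> top"
        using fin ennreal_suminf_lessD[OF fin, of i] by auto
      then obtain h where h: "hausdorff_pre s \<delta> (A i) = ennreal h" "0 \<le> h"
        by (cases "hausdorff_pre s \<delta> (A i)" rule: ennreal_cases) auto
      have "ennreal h < ennreal (h + \<epsilon> i)"
        using e h(2) by (intro ennreal_lessI) (auto simp: \<epsilon>_def add_nonneg_pos)
      then show ?thesis
        using e h by (simp add: \<epsilon>_def)
    qed
    then obtain C where "C \<in> {C. A i \<subseteq> (\<Union>i. C i) \<and> (\<forall>i. bounded (C i) \<and> diameter (C i) \<le> \<delta>)}"
       "(\<Sum>j. ennreal (diameter (C j) powr s)) < hausdorff_pre s \<delta> (A i) + ennreal (\<epsilon> i)"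
      unfolding hausdorff_pre_def[of s \<delta> "A i"] INF_less_iff by blast
    then show ?thesis by (intro exI[of _ C]) auto
  qed
  then obtain C where C: "\<And>i. A i \<subseteq> (\<Union>j. C i j)" "\<And>i j. bounded (C i j)" "\<And>i j. diameter (C i j) \<le> \<delta>"
      "\<And>i. (\<Sum>j. ennreal (diameter (C i j) powr s)) \<le> hausdorff_pre s \<delta> (A i) + ennreal (\<epsilon> i)"
    by metis
  define C' where "C' = (\<lambda>n. case prod_decode n of (i, j) \<Rightarrow> C i j)"
  have "(\<Union>i. A i) \<subseteq> (\<Union>n. C' n)"
  proof
    fix x assume "x \<in> (\<Union>i. A i)"
    then obtain i j where "x \<in> C i j" using C(1) by blast
    then have "x \<in> C' (prod_encode (i, j))" by (simp add: C'_def)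
    then show "x \<in> (\<Union>n. C' n)" by blast
  qed
  then have "hausdorff_pre s \<delta> (\<Union>i. A i) \<le> (\<Sum>n. ennreal (diameter (C' n) powr s))"
    unfolding hausdorff_pre_def using C(2,3)
    by (intro INF_lower) (simp add: C'_def split: prod.split)
  also have "\<dots> = (\<Sum>n. (\<lambda>(i, j). ennreal (diameter (C i j) powr s)) (prod_decode n))"
    by (intro suminf_cong) (auto simp: C'_def split: prod.splits)
  also have "\<dots> = (\<Sum>i. \<Sum>j. ennreal (diameter (C i j) powr s))"
    by (rule suminf_ennreal_2dimen[unfolded comp_def]) simp
  also have "\<dots> \<le> (\<Sum>i. hausdorff_pre s \<delta> (A i) + ennreal (\<epsilon> i))"
    by (intro suminf_le C(4)) auto
  also have "\<dots> = (\<Sum>i. hausdorff_pre s \<delta> (A i)) + (\<Sum>i. ennreal (\<epsilon> i))"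
    by (intro suminf_add[symmetric]) auto
  also have "(\<Sum>i. ennreal (\<epsilon> i)) = ennreal e"
  proof -
    have "\<epsilon> sums (e * 1)"
      unfolding \<epsilon>_def by (intro sums_mult power_half_series)
    then show ?thesis
      using e by (intro suminf_ennreal_eq) (auto simp: \<epsilon>_def)
  qed
  finally show "hausdorff_pre s \<delta> (\<Union>i. A i) \<le> (\<Sum>i. hausdorff_pre s \<delta> (A i)) + ennreal e" .
qed

lemma hausdorff_pre_finite_cballs:
  fixes x :: "'i \<Rightarrow> 'a::euclidean_space"
  assumes "finite I" "A \<subseteq> (\<Union>i\<in>I. cball (x i) (R i))" "\<And>i. i \<in> I \<Longrightarrow> 0 \<le> R i \<and> 2 * R i \<le> \<delta>" "0 \<le> \<delta>"
  shows "hausdorff_pre s \<delta> A \<le> (\<Sum>i\<in>I. ennreal ((2 * R i) powr s))"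
proof -
  obtain f where f: "bij_betw f {..<card I} I"
    using ex_bij_betw_nat_finite[OF assms(1)] by (metis atLeast0LessThan)
  \<comment> \<open>The finite cover is padded with empty sets. They cost nothing since
    \<open>0 powr s = 0\<close> for every \<open>s\<close>, and they are admissible because
    \<open>0 \<le> \<delta>\<close>.\<close>
  define C where "C = (\<lambda>n. if n < card I then cball (x (f n)) (R (f n)) else {})"
  have fI: "n < card I \<Longrightarrow> f n \<in> I" for n
    using f by (auto simp: bij_betw_def)
  have "A \<subseteq> (\<Union>n. C n)"
  proof
    fix y assume "y \<in> A"
    then obtain i where i: "i \<in> I" "y \<in> cball (x i) (R i)" using assms(2) by blast
    then obtain n where "n < card I" "f n = i"
      using f by (metis bij_betw_iff_bijections lessThan_iff)
    then have "y \<in> C n" using i by (simp add: C_def)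
    then show "y \<in> (\<Union>n. C n)" by blast
  qed
  moreover have "diameter (C n) \<le> \<delta>" for n
    using assms(3)[OF fI, of n] assms(4) by (auto simp: C_def not_less)
  ultimately have "hausdorff_pre s \<delta> A \<le> (\<Sum>n. ennreal (diameter (C n) powr s))"
    unfolding hausdorff_pre_def by (intro INF_lower) (auto simp: C_def)
  also have "\<dots> = (\<Sum>n<card I. ennreal (diameter (C n) powr s))"
    by (rule suminf_finite) (auto simp: C_def)
  also have "\<dots> = (\<Sum>n<card I. ennreal ((2 * R (f n)) powr s))"
    using assms(3)[OF fI] by (intro sum.cong) (auto simp: C_def not_less)
  also have "\<dots> = (\<Sum>i\<in>I. ennreal ((2 * R i) powr s))"
    by (rule sum.reindex_bij_betw[OF f])
  finally show ?thesis .
qed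

lemma hausdorff_null_cover:
  assumes "hausdorff_measure s A = 0" "\<delta> > 0" "\<epsilon> > 0"
  obtains C where "A \<subseteq> (\<Union>i::nat. C i)" "\<And>i. bounded (C i)" "\<And>i. diameter (C i) \<le> \<delta>"
    "(\<Sum>i. ennreal (diameter (C i) powr s)) < \<epsilon>"
proof -
  have "hausdorff_pre s \<delta> A < \<epsilon>"
    using hausdorff_pre_le_measure[OF assms(2), of s A] assms by simp
  then show ?thesis
    unfolding hausdorff_pre_def INF_less_iff using that by blast
qed

lemma hausdorff_measure_zeroI:
  assumes "\<And>\<delta>. \<delta> > 0 \<Longrightarrow> hausdorff_pre s \<delta> A = 0"
  shows "hausdorff_measure s A = 0"
proof -
  have "hausdorff_measure s A \<le> 0"
    unfolding hausdorff_measure_def using assms by (intro SUP_least) auto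
  then show ?thesis by simp
qed

text \<open>The dimension is an infimum, so exponents slightly above \<open>T\<close> determine the
  bound. This allows the exceptional set to be treated only for
  \<open>t < DIM('a) - 1\<close>.\<close>

lemma hausdorff_dim_le:
  assumes "0 \<le> T" "T < U" "\<And>t. T < t \<Longrightarrow> t < U \<Longrightarrow> hausdorff_measure t A = 0"
  shows "hausdorff_dim A \<le> ereal T"
proof (cases "A = {}")
  case False
  have "Inf {ereal t | t. 0 \<le> t \<and> hausdorff_measure t A = 0} \<le> ereal T"
  proof (rule ereal_le_epsilon2)
    fix e :: real assume e: "0 < e"
    define t where "t = T + min e ((U - T) / 2)"
    have t: "T < t" "t < U" "t \<le> T + e"
      using e assms(2) by (auto simp: t_def min_def field_simps)
    have "Inf {ereal t | t. 0 \<le> t \<and> hausdorff_measure t A = 0} \<le> ereal t"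
      using assms t by (intro Inf_lower) auto
    also have "\<dots> \<le> ereal T + ereal e" using t by simp
    finally show "Inf {ereal t | t. 0 \<le> t \<and> hausdorff_measure t A = 0} \<le> ereal T + ereal e" .
  qed
  then show ?thesis using False by (simp add: hausdorff_dim_def)
qed (simp add: hausdorff_dim_def)

text \<open>Greedy choice: every new point receives the largest weight that respects all the
  constraints, so one of the constraints through it becomes tight, and tight constraints stay tight.\<close>

lemma exists_saturating_weights:
  fixes cap :: "'i \<Rightarrow> real" and B :: "'i \<Rightarrow> 'a set"
  assumes "finite P" "finite I" "\<And>i. i \<in> I \<Longrightarrow> cap i \<ge> 0" "P \<subseteq> (\<Union>i\<in>I. B i)"
  shows "\<exists>w::'a \<Rightarrow> real. (\<forall>p. w p \<ge> 0) \<and> (\<forall>i\<in>I. sum w (P \<inter> B i) \<le> cap i) \<and>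
      (\<forall>p\<in>P. \<exists>i\<in>I. p \<in> B i \<and> sum w (P \<inter> B i) = cap i)"
  using assms(1,4)
proof (induction P rule: finite_induct)
  case empty
  then show ?case using assms by (intro exI[of _ "\<lambda>_. 0"]) auto
next
  case (insert q P)
  then obtain w where w: "\<And>p. w p \<ge> 0" "\<And>i. i \<in> I \<Longrightarrow> sum w (P \<inter> B i) \<le> cap i"
      "\<And>p. p \<in> P \<Longrightarrow> \<exists>i\<in>I. p \<in> B i \<and> sum w (P \<inter> B i) = cap i"
    by (metis insert_subset)
  define J where "J = {i \<in> I. q \<in> B i}"
  have J: "finite J" "J \<noteq> {}" using assms(2) insert by (auto simp: J_def)
  define z where "z = Min ((\<lambda>i. cap i - sum w (P \<inter> B i)) ` J)"
  have zle: "z \<le> cap i - sum w (P \<inter> B i)" if "i \<in> J" for i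
    unfolding z_def using J that by (intro Min_le) auto
  have "z \<in> (\<lambda>i. cap i - sum w (P \<inter> B i)) ` J"
    unfolding z_def using J by (intro Min_in) auto
  then obtain j where j: "j \<in> J" "z = cap j - sum w (P \<inter> B j)" by blast
  have z0: "z \<ge> 0" using j w(2) by (auto simp: J_def)
  define w' where "w' = w(q := z)"
  have same: "sum w' (P \<inter> B i) = sum w (P \<inter> B i)" for i
    using insert by (intro sum.cong) (auto simp: w'_def)
  have S: "sum w' (insert q P \<inter> B i) = (if q \<in> B i then z else 0) + sum w (P \<inter> B i)" for i
    using insert same[of i] by (auto simp: Int_insert_left w'_def)
  show ?case
  proof (intro exI[of _ w'] conjI ballI allI)
    show "w' p \<ge> 0" for p using w z0 by (simp add: w'_def)
    show "sum w' (insert q P \<inter> B i) \<le> cap i" if "i \<in> I" for i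
      using zle[of i] w(2)[OF that] that unfolding S by (auto simp: J_def)
    show "\<exists>i\<in>I. p \<in> B i \<and> sum w' (insert q P \<inter> B i) = cap i" if pin: "p \<in> insert q P" for p
    proof (cases "p = q")
      case True
      then show ?thesis using j unfolding S by (intro bexI[of _ j]) (auto simp: J_def)
    next
      case False
      then obtain i where i: "i \<in> I" "p \<in> B i" "sum w (P \<inter> B i) = cap i" using w(3) pin by blast
      have "q \<in> B i \<Longrightarrow> z = 0" using zle[of i] i z0 by (auto simp: J_def)
      then show ?thesis using i unfolding S by (intro bexI[of _ i]) auto
    qed
  qed
qed

text \<open>A discrete Frostman lemma. The weights are saturated with respect to balls around points
  of \<open>P\<close> with dyadic radii from \<open>r\<close> to \<open>2^J * r\<close>; the tight
  balls cover \<open>P\<close>, and a disjoint Vitali subfamily bounds the content by the total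
  weight. The constant 12 comes from the factor 5 of Vitali, one more radius to pass from
  \<open>P\<close> to its \<open>r\<close>-neighbourhood, and doubling from radius to
  diameter.\<close>

lemma finite_frostman:
  fixes P :: "'a::euclidean_space set"
  assumes "finite P" "0 < r" "0 < t"
  obtains w where "\<And>p. w p \<ge> 0"
    "\<And>x j. x \<in> P \<Longrightarrow> j \<le> J \<Longrightarrow> sum w (P \<inter> cball x (2^j * r)) \<le> (2^j * r) powr t"
    "\<And>E \<delta>. E \<subseteq> (\<Union>p\<in>P. cball p r) \<Longrightarrow> 0 < \<delta> \<Longrightarrow> 12 powr t * sum w P \<le> \<delta> powr t \<Longrightarrow>
       hausdorff_pre t \<delta> E \<le> ennreal (12 powr t * sum w P)"
proof -
  define I where "I = P \<times> {..J}"
  define R where "R = (\<lambda>i::'a \<times> nat. 2 ^ snd i * r)"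
  have R: "R i \<ge> r" "R i > 0" for i
    using assms(2) unfolding R_def by (auto simp: mult_le_cancel_right1)
  have "\<exists>w. (\<forall>p. w p \<ge> 0) \<and> (\<forall>i\<in>I. sum w (P \<inter> cball (fst i) (R i)) \<le> R i powr t) \<and>
      (\<forall>p\<in>P. \<exists>i\<in>I. p \<in> cball (fst i) (R i) \<and> sum w (P \<inter> cball (fst i) (R i)) = R i powr t)"
    using assms by (intro exists_saturating_weights) (force simp: I_def R_def)+
  then obtain w where w: "\<And>p. w p \<ge> 0" "\<And>i. i \<in> I \<Longrightarrow> sum w (P \<inter> cball (fst i) (R i)) \<le> R i powr t"
      "\<And>p. p \<in> P \<Longrightarrow> \<exists>i\<in>I. p \<in> cball (fst i) (R i) \<and> sum w (P \<inter> cball (fst i) (R i)) = R i powr t"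
    by blast
  show ?thesis
  proof (rule that)
    show "w p \<ge> 0" for p by (rule w)
    show "sum w (P \<inter> cball x (2^j * r)) \<le> (2^j * r) powr t" if "x \<in> P" "j \<le> J" for x j
      using w(2)[of "(x, j)"] that by (simp add: I_def R_def)
    fix E \<delta> assume E: "E \<subseteq> (\<Union>p\<in>P. cball p r)" and \<delta>: "0 < \<delta>" "12 powr t * sum w P \<le> \<delta> powr t"
    define K where "K = {i\<in>I. sum w (P \<inter> cball (fst i) (R i)) = R i powr t}"
    have K: "finite K" "P \<subseteq> (\<Union>i\<in>K. cball (fst i) (R i))"
      using assms(1) w(3) by (auto simp: K_def I_def, blast)
    have Rb: "\<And>i. i \<in> K \<Longrightarrow> 0 < R i \<and> R i \<le> 2 ^ J * r"
      using R(2) assms(2) by (auto simp: K_def I_def R_def)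
    obtain C where "countable C" and C: "C \<subseteq> K"
      "pairwise (\<lambda>i j. disjnt (cball (fst i) (R i)) (cball (fst j) (R j))) C"
      "P \<subseteq> (\<Union>i\<in>C. cball (fst i) (5 * R i))"
      by (rule Vitali_covering_lemma_cballs[OF K(2) Rb])
    have finC: "finite C" using C(1) K(1) finite_subset by blast
    have "(\<Sum>i\<in>C. R i powr t) = (\<Sum>i\<in>C. sum w (P \<inter> cball (fst i) (R i)))"
      using C(1) by (intro sum.cong) (auto simp: K_def)
    also have "\<dots> = sum w (\<Union>i\<in>C. P \<inter> cball (fst i) (R i))"
    proof (rule sum.UNION_disjoint[symmetric])
      show "\<forall>i\<in>C. \<forall>j\<in>C. i \<noteq> j \<longrightarrow> P \<inter> cball (fst i) (R i) \<inter> (P \<inter> cball (fst j) (R j)) = {}"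
        using C(2) unfolding pairwise_def disjnt_def by blast
    qed (use finC assms in auto)
    also have "\<dots> \<le> sum w P"
      using assms w by (intro sum_mono2) auto
    finally have sumR: "(\<Sum>i\<in>C. R i powr t) \<le> sum w P" .
    \<comment> \<open>The enlarged balls must be admissible at mesh \<open>\<delta>\<close>: a ball
      that is too large would alone outweigh \<open>sum w P\<close>, by the hypothesis on
      \<open>\<delta>\<close>.\<close>
    have small: "12 * R i \<le> \<delta>" if "i \<in> C" for i
    proof (rule ccontr)
      assume "\<not> 12 * R i \<le> \<delta>"
      then have "\<delta> powr t < (12 * R i) powr t"
        using \<delta> assms by (intro powr_less_mono2) auto
      also have "\<dots> = 12 powr t * R i powr t"
        using R(2)[of i] by (simp add: powr_mult)
      also have "R i powr t \<le> (\<Sum>i\<in>C. R i powr t)"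
        using that finC by (intro member_le_sum) auto
      finally have "\<delta> powr t < 12 powr t * (\<Sum>i\<in>C. R i powr t)" by simp
      then show False using \<delta>(2) mult_left_mono[OF sumR powr_ge_zero[of 12 t]] by linarith
    qed
    have "E \<subseteq> (\<Union>i\<in>C. cball (fst i) (6 * R i))"
    proof
      fix y assume "y \<in> E"
      then obtain p where p: "p \<in> P" "dist p y \<le> r" using E by auto
      then obtain i where i: "i \<in> C" "dist (fst i) p \<le> 5 * R i" using C(3) by auto
      have "dist (fst i) y \<le> dist (fst i) p + dist p y" by (rule dist_triangle)
      then have "dist (fst i) y \<le> 6 * R i" using i p R(1)[of i] by linarith
      then show "y \<in> (\<Union>i\<in>C. cball (fst i) (6 * R i))" using i by auto
    qed
    then have "hausdorff_pre t \<delta> E \<le> (\<Sum>i\<in>C. ennreal ((2 * (6 * R i)) powr t))"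
      using finC R(2) small \<delta> by (intro hausdorff_pre_finite_cballs) (auto simp: less_imp_le)
    also have "\<dots> = ennreal (12 powr t * (\<Sum>i\<in>C. R i powr t))"
      using R(2) by (simp add: sum_ennreal powr_mult sum_distrib_left less_imp_le)
    also have "\<dots> \<le> ennreal (12 powr t * sum w P)"
      using sumR by (intro ennreal_leI mult_left_mono) auto
    finally show "hausdorff_pre t \<delta> E \<le> ennreal (12 powr t * sum w P)" .
  qed
qed

subsection \<open>Oscillation between consecutive scales\<close>

text \<open>For the least \<open>j\<close> with \<open>\<rho> \<le> 2^j * r\<close> one has
  \<open>(2^j * r / 2)\<^sup>2 \<le> r\<^sup>2/4 + \<rho>\<^sup>2\<close>, so the single term of
  that index suffices, at the cost of a factor \<open>2 powr m\<close>.\<close>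

lemma powr_kernel_le_dyadic_sum:
  fixes r \<rho> m :: real
  assumes "0 < r" "0 \<le> \<rho>" "\<rho> \<le> 2^J * r" "0 \<le> m"
  shows "(r\<^sup>2/4 + \<rho>\<^sup>2) powr (-m/2) \<le> 2 powr m * (\<Sum>j\<le>J. if \<rho> \<le> 2^j * r then (2^j * r) powr (-m) else 0)"
proof -
  define j where "j = (LEAST j. \<rho> \<le> 2^j * r)"
  have j: "\<rho> \<le> 2^j * r" unfolding j_def using assms(3) by (rule LeastI)
  have jJ: "j \<le> J" unfolding j_def using assms(3) by (rule Least_le)
  have "(2^j * r / 2)\<^sup>2 \<le> r\<^sup>2/4 + \<rho>\<^sup>2"
  proof (cases j)
    case 0
    then show ?thesis by (simp add: power_divide)
  next
    case (Suc i)
    then have "\<not> \<rho> \<le> 2^i * r" using not_less_Least[of i "\<lambda>j. \<rho> \<le> 2^j * r"] j_def by simp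
    then have "(2^i * r)\<^sup>2 \<le> \<rho>\<^sup>2" using assms by (intro power_mono) auto
    moreover have e: "2^j * r / 2 = 2^i * r" using Suc by simp
    ultimately show ?thesis unfolding e by (simp add: add_increasing)
  qed
  then have "(r\<^sup>2/4 + \<rho>\<^sup>2) powr (-m/2) \<le> ((2^j * r / 2)\<^sup>2) powr (-m/2)"
    using assms by (intro powr_mono2') auto
  also have "\<dots> = (2^j * r / 2) powr (-m)"
    using assms by (simp add: powr_powr powr_numeral[symmetric] del: powr_numeral)
  also have "\<dots> = 2 powr m * (2^j * r) powr (-m)"
    using assms by (simp add: powr_divide powr_minus divide_simps)
  also have "\<dots> \<le> 2 powr m * (\<Sum>j\<le>J. if \<rho> \<le> 2^j * r then (2^j * r) powr (-m) else 0)"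
  proof (rule mult_left_mono)
    have "(2^j * r) powr (-m) = (if \<rho> \<le> 2^j * r then (2^j * r) powr (-m) else 0)" using j by simp
    also have "\<dots> \<le> (\<Sum>j\<le>J. if \<rho> \<le> 2^j * r then (2^j * r) powr (-m) else 0)"
      using jJ by (intro member_le_sum) auto
    finally show "(2^j * r) powr (-m) \<le> (\<Sum>j\<le>J. if \<rho> \<le> 2^j * r then (2^j * r) powr (-m) else 0)" .
  qed simp
  finally show ?thesis .
qed

text \<open>By the ball condition the dyadic scale \<open>2^j * r\<close> around \<open>x\<close>
  contributes at most a multiple of \<open>(2^j * r) powr (t - m)\<close>. Since
  \<open>t < m\<close>, these terms form a geometric series dominated by the finest scale
  \<open>r\<close>.\<close>

lemma discrete_energy_le:
  fixes P :: "'a::euclidean_space set" and w :: "'a \<Rightarrow> real"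
  assumes "finite P" "0 < r" "0 \<le> m" "t < m" "\<And>p. w p \<ge> 0"
    and frost: "\<And>x j. x \<in> P \<Longrightarrow> j \<le> J \<Longrightarrow> sum w (P \<inter> cball x (2^j * r)) \<le> (2^j * r) powr t"
    and diam: "\<And>x y. x \<in> P \<Longrightarrow> y \<in> P \<Longrightarrow> dist x y \<le> 2^J * r"
  shows "(\<Sum>x\<in>P. \<Sum>y\<in>P. w x * w y * (r\<^sup>2/4 + (norm (x - y))\<^sup>2) powr (-m/2))
    \<le> (2 powr m / (1 - 2 powr (t - m))) * r powr (t - m) * sum w P"
proof -
  define q where "q = 2 powr (t - m)"
  have q: "0 < q" "q < 1" using assms(4) by (auto simp: q_def powr_less_one)
  have pot: "(\<Sum>y\<in>P. w y * (r\<^sup>2/4 + (norm (x - y))\<^sup>2) powr (-m/2)) \<le> 2 powr m / (1 - q) * r powr (t - m)"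
    if x: "x \<in> P" for x
  proof -
    have "(\<Sum>y\<in>P. w y * (r\<^sup>2/4 + (norm (x - y))\<^sup>2) powr (-m/2))
       \<le> (\<Sum>y\<in>P. w y * (2 powr m * (\<Sum>j\<le>J. if norm (x - y) \<le> 2^j * r then (2^j * r) powr (-m) else 0)))"
      using assms diam[OF x] by (intro sum_mono mult_left_mono powr_kernel_le_dyadic_sum) (auto simp: dist_norm)
    also have "\<dots> = 2 powr m * (\<Sum>j\<le>J. \<Sum>y\<in>P. if norm (x - y) \<le> 2^j * r then w y * (2^j * r) powr (-m) else 0)"
      by (subst sum.swap) (auto simp: sum_distrib_left intro!: sum.cong)
    also have "\<dots> \<le> 2 powr m * (\<Sum>j\<le>J. q ^ j * r powr (t - m))"
    proof (intro mult_left_mono sum_mono)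
      fix j assume "j \<in> {..J}"
      then have jJ: "j \<le> J" by simp
      have "(\<Sum>y\<in>P. if norm (x - y) \<le> 2^j * r then w y * (2^j * r) powr (-m) else 0)
         = (\<Sum>y\<in>P \<inter> cball x (2^j * r). w y * (2^j * r) powr (-m))"
        using assms(1) by (intro sum.mono_neutral_cong_right) (auto simp: dist_norm)
      also have "\<dots> = sum w (P \<inter> cball x (2^j * r)) * (2^j * r) powr (-m)"
        by (simp add: sum_distrib_right)
      also have "\<dots> \<le> (2^j * r) powr t * (2^j * r) powr (-m)"
        by (intro mult_right_mono frost x jJ) auto
      also have "\<dots> = (2^j * r) powr (t - m)"
        by (simp add: powr_add[symmetric])
      also have "\<dots> = (2^j) powr (t - m) * r powr (t - m)"
        using assms(2) by (simp add: powr_mult)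
      also have "(2^j::real) powr (t - m) = q ^ j"
        by (simp add: q_def powr_power powr_powr mult.commute flip: powr_realpow)
      finally show "(\<Sum>y\<in>P. if norm (x - y) \<le> 2^j * r then w y * (2^j * r) powr (-m) else 0) \<le> q ^ j * r powr (t - m)" .
    qed simp
    also have "\<dots> = 2 powr m * (\<Sum>j\<le>J. q ^ j) * r powr (t - m)"
      by (simp add: sum_distrib_right)
    also have "\<dots> \<le> 2 powr m * (1 / (1 - q)) * r powr (t - m)"
    proof (intro mult_right_mono mult_left_mono)
      have "(\<Sum>j\<le>J. q ^ j) \<le> (\<Sum>j. q ^ j)"
        using q by (intro sum_le_suminf summable_geometric) auto
      also have "\<dots> = 1 / (1 - q)" using q by (intro suminf_geometric) auto
      finally show "(\<Sum>j\<le>J. q ^ j) \<le> 1 / (1 - q)" .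
    qed auto
    finally show ?thesis by simp
  qed
  have "(\<Sum>x\<in>P. \<Sum>y\<in>P. w x * w y * (r\<^sup>2/4 + (norm (x - y))\<^sup>2) powr (-m/2))
     = (\<Sum>x\<in>P. w x * (\<Sum>y\<in>P. w y * (r\<^sup>2/4 + (norm (x - y))\<^sup>2) powr (-m/2)))"
    by (simp add: sum_distrib_left mult.assoc)
  also have "\<dots> \<le> (\<Sum>x\<in>P. w x * (2 powr m / (1 - q) * r powr (t - m)))"
    using assms by (intro sum_mono mult_left_mono pot) auto
  also have "\<dots> = (2 powr m / (1 - q)) * r powr (t - m) * sum w P"
    by (simp only: sum_distrib_right[symmetric] mult.commute)
  finally show ?thesis by (simp add: q_def)
qed

text \<open>The counterpart of \<open>smoothing_pairing\<close>, with equal scales, for the discrete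
  measure that has mass \<open>w x\<close> at each point \<open>x\<close> of
  \<open>P\<close>.\<close>

lemma line_kernel_sum_L2:
  fixes P :: "'a::euclidean_space set" and w :: "'a \<Rightarrow> real"
  assumes "finite P" "\<And>p. w p \<ge> 0" "0 < c" "c < 1"
  shows "(\<integral>\<^sup>+p. ennreal (gauss_weight (fst p) * slab_weight (fst p) (snd p) * (\<Sum>x\<in>P. w x * line_kernel c (fst p) (snd p - x))\<^sup>2) \<partial>(lborel \<Otimes>\<^sub>M lborel))
     = ennreal (\<Sum>x\<in>P. \<Sum>y\<in>P. w x * w y * (2 * c + (norm (x - y))\<^sup>2) powr (-(real DIM('a) - 1)/2))"
proof -
  let ?L = "lborel \<Otimes>\<^sub>M lborel :: ('a \<times> 'a) measure"
  define F where "F = (\<lambda>(x::'a) (y::'a) (p::'a \<times> 'a). gauss_weight (fst p) * slab_weight (fst p) (snd p) * line_kernel c (fst p) (snd p - x) * line_kernel c (fst p) (snd p - y) :: real)"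
  have [measurable]: "F x y \<in> borel_measurable ?L" for x y
    unfolding F_def by measurable
  have F0: "F x y p \<ge> 0" for x y p by (simp add: F_def)
  have int: "(\<integral>\<^sup>+p. ennreal (F x y p) \<partial>?L) = ennreal ((2 * c + (norm (x - y))\<^sup>2) powr (-(real DIM('a) - 1)/2))" for x y
  proof -
    have "(\<integral>\<^sup>+p. ennreal (F x y p) \<partial>?L) = (\<integral>\<^sup>+v. (\<integral>\<^sup>+h. ennreal (F x y (v, h)) \<partial>lborel) \<partial>lborel)"
      by (rule lborel.nn_integral_fst[symmetric]) measurable
    then show ?thesis
      using line_kernel_pairing[OF assms(3,4,3), of x y] by (simp only: F_def fst_conv snd_conv mult_2)
  qed
  have "(\<integral>\<^sup>+p. ennreal (gauss_weight (fst p) * slab_weight (fst p) (snd p) * (\<Sum>x\<in>P. w x * line_kernel c (fst p) (snd p - x))\<^sup>2) \<partial>?L)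
     = (\<integral>\<^sup>+p. (\<Sum>x\<in>P. \<Sum>y\<in>P. ennreal (w x * w y) * ennreal (F x y p)) \<partial>?L)"
  proof (rule nn_integral_cong)
    fix p :: "'a \<times> 'a"
    have "gauss_weight (fst p) * slab_weight (fst p) (snd p) * (\<Sum>x\<in>P. w x * line_kernel c (fst p) (snd p - x))\<^sup>2
       = (\<Sum>x\<in>P. \<Sum>y\<in>P. (w x * w y) * F x y p)"
      by (simp only: power2_eq_square sum_product) (simp only: sum_distrib_left F_def ac_simps)
    then show "ennreal (gauss_weight (fst p) * slab_weight (fst p) (snd p) * (\<Sum>x\<in>P. w x * line_kernel c (fst p) (snd p - x))\<^sup>2)
       = (\<Sum>x\<in>P. \<Sum>y\<in>P. ennreal (w x * w y) * ennreal (F x y p))"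
      using assms(2) F0 by (simp add: sum_ennreal[symmetric] sum_nonneg ennreal_mult)
  qed
  also have "\<dots> = (\<Sum>x\<in>P. \<Sum>y\<in>P. ennreal (w x * w y) * ennreal ((2 * c + (norm (x - y))\<^sup>2) powr (-(real DIM('a) - 1)/2)))"
    by (simp add: nn_integral_sum nn_integral_cmult int)
  also have "\<dots> = ennreal (\<Sum>x\<in>P. \<Sum>y\<in>P. w x * w y * (2 * c + (norm (x - y))\<^sup>2) powr (-(real DIM('a) - 1)/2))"
    using assms(2) by (simp add: sum_ennreal[symmetric] sum_nonneg ennreal_mult)
  finally show ?thesis .
qed

section \<open>Cauchy-Schwarz over the space of lines\<close>

context finite_euclidean_measure
begin

text \<open>Since \<open>smoothing\<close> takes a squared width, this compares tubes of widths
  \<open>r/2\<close> and \<open>r\<close>.\<close>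

definition oscillation :: "real \<Rightarrow> 'a \<Rightarrow> ennreal" where
  "oscillation r x = (\<integral>\<^sup>+v. ennreal (gauss_weight v * \<bar>smoothing (r\<^sup>2/4) v x - smoothing (r\<^sup>2) v x\<bar>) \<partial>lborel)"

text \<open>By \<open>smoothing_difference_le\<close> a kernel of scale \<open>r\<^sup>2/8\<close>
  is split off and joined with the weights \<open>w\<close>. Cauchy-Schwarz then separates the
  smoothed point masses, whose square is a discrete energy, from a difference of smoothings
  controlled by the energy of \<open>\<mu>\<close>.\<close>

lemma oscillation_sum_le:
  fixes w :: "'a \<Rightarrow> real"
  assumes "finite P" "\<And>p. w p \<ge> 0" "0 < r" "r \<le> 1" "0 \<le> s" "s \<le> real DIM('a) + 1"
  shows "(\<Sum>x\<in>P. ennreal (w x) * oscillation r x)\<^sup>2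
    \<le> ennreal (\<Sum>x\<in>P. \<Sum>y\<in>P. w x * w y * (r\<^sup>2/4 + (norm (x - y))\<^sup>2) powr (-(real DIM('a) - 1)/2))
      * (ennreal ((real DIM('a) - 1) * 4 powr ((real DIM('a) + 1 - s)/2) * r powr (s - (real DIM('a) - 1))) * energy s \<mu>)"
proof -
  let ?L = "lborel \<Otimes>\<^sub>M lborel :: ('a \<times> 'a) measure"
  define c where "c = r\<^sup>2/8"
  have r2: "0 < r\<^sup>2" "r\<^sup>2 \<le> 1" using assms by (auto simp: power_le_one)
  have c: "0 < c" "c < 1" "c + r\<^sup>2/8 = r\<^sup>2/4" "c + 7*r\<^sup>2/8 = r\<^sup>2" "2 * c = r\<^sup>2/4"
    using r2 by (auto simp: c_def)
  define W where "W = (\<lambda>p::'a \<times> 'a. gauss_weight (fst p) * slab_weight (fst p) (snd p))"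
  define D where "D = (\<lambda>p. \<bar>smoothing (r\<^sup>2/8) (fst p) (snd p) - smoothing (7*r\<^sup>2/8) (fst p) (snd p)\<bar>)"
  define N where "N = (\<lambda>p. \<Sum>x\<in>P. w x * line_kernel c (fst p) (snd p - x))"
  have [measurable]: "W \<in> borel_measurable ?L" "D \<in> borel_measurable ?L" "N \<in> borel_measurable ?L"
    unfolding W_def D_def N_def by measurable
  have nn: "W p \<ge> 0" "D p \<ge> 0" "N p \<ge> 0" for p
    using assms(2) by (auto simp: W_def D_def N_def sum_nonneg)
  have osc: "oscillation r x \<le> (\<integral>\<^sup>+p. ennreal (W p * line_kernel c (fst p) (snd p - x) * D p) \<partial>?L)" for x
  proof -
    have "oscillation r x \<le> (\<integral>\<^sup>+v. (\<integral>\<^sup>+h. ennreal (W (v, h) * line_kernel c v (h - x) * D (v, h)) \<partial>lborel) \<partial>lborel)"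
      unfolding oscillation_def
    proof (rule nn_integral_mono_AE)
      have "AE v in lborel. v \<noteq> (0::'a)" by (rule AE_lborel_singleton)
      then show "AE v in lborel. ennreal (gauss_weight v * \<bar>smoothing (r\<^sup>2/4) v x - smoothing (r\<^sup>2) v x\<bar>)
         \<le> (\<integral>\<^sup>+h. ennreal (W (v, h) * line_kernel c v (h - x) * D (v, h)) \<partial>lborel)"
      proof eventually_elim
        case (elim v)
        have "ennreal (gauss_weight v * \<bar>smoothing (r\<^sup>2/4) v x - smoothing (r\<^sup>2) v x\<bar>)
          = ennreal (gauss_weight v) * ennreal \<bar>smoothing (r\<^sup>2/4) v x - smoothing (r\<^sup>2) v x\<bar>"
          by (simp add: ennreal_mult)
        also have "\<dots> \<le> ennreal (gauss_weight v) * (\<integral>\<^sup>+h. ennreal (slab_weight v h * line_kernel c v (h - x)) * ennreal (D (v, h)) \<partial>lborel)"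
          using smoothing_difference_le[OF c(1,2) _ _ elim, of "r\<^sup>2/8" "7*r\<^sup>2/8" x] r2(1) unfolding c(3,4) D_def
          by (intro mult_left_mono) auto
        also have "\<dots> = (\<integral>\<^sup>+h. ennreal (gauss_weight v) * (ennreal (slab_weight v h * line_kernel c v (h - x)) * ennreal (D (v, h))) \<partial>lborel)"
          unfolding D_def fst_conv snd_conv by (rule nn_integral_cmult[symmetric]) measurable
        also have "\<dots> = (\<integral>\<^sup>+h. ennreal (W (v, h) * line_kernel c v (h - x) * D (v, h)) \<partial>lborel)"
          using nn by (intro nn_integral_cong) (simp add: W_def ennreal_mult mult.assoc)
        finally show ?case .
      qed
    qed
    also have "\<dots> = (\<integral>\<^sup>+p. ennreal (W p * line_kernel c (fst p) (snd p - x) * D p) \<partial>?L)"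
      by (subst lborel.nn_integral_fst[symmetric]) auto
    finally show ?thesis .
  qed
  have "(\<Sum>x\<in>P. ennreal (w x) * oscillation r x)
      \<le> (\<Sum>x\<in>P. ennreal (w x) * (\<integral>\<^sup>+p. ennreal (W p * line_kernel c (fst p) (snd p - x) * D p) \<partial>?L))"
    by (intro sum_mono mult_left_mono osc) auto
  also have "\<dots> = (\<integral>\<^sup>+p. (\<Sum>x\<in>P. ennreal (w x) * ennreal (W p * line_kernel c (fst p) (snd p - x) * D p)) \<partial>?L)"
    by (subst nn_integral_sum) (auto simp: nn_integral_cmult)
  also have "\<dots> = (\<integral>\<^sup>+p. ennreal (sqrt (W p) * N p) * ennreal (sqrt (W p) * D p) \<partial>?L)"
  proof (rule nn_integral_cong)
    fix p
    have "(\<Sum>x\<in>P. ennreal (w x) * ennreal (W p * line_kernel c (fst p) (snd p - x) * D p))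
       = ennreal (\<Sum>x\<in>P. w x * (W p * line_kernel c (fst p) (snd p - x) * D p))"
      using assms(2) nn by (simp add: sum_ennreal[symmetric] ennreal_mult)
    also have "(\<Sum>x\<in>P. w x * (W p * line_kernel c (fst p) (snd p - x) * D p)) = (sqrt (W p) * sqrt (W p)) * N p * D p"
      using nn(1)[of p] unfolding N_def sum_distrib_left sum_distrib_right
      by (intro sum.cong refl) simp
    finally show "(\<Sum>x\<in>P. ennreal (w x) * ennreal (W p * line_kernel c (fst p) (snd p - x) * D p))
       = ennreal (sqrt (W p) * N p) * ennreal (sqrt (W p) * D p)"
      using nn[of p] by (simp add: ennreal_mult[symmetric] ac_simps)
  qed
  finally have "(\<Sum>x\<in>P. ennreal (w x) * oscillation r x)\<^sup>2
     \<le> (\<integral>\<^sup>+p. ennreal (sqrt (W p) * N p) * ennreal (sqrt (W p) * D p) \<partial>?L)\<^sup>2"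
    by (rule power_mono) simp
  also have "\<dots> \<le> (\<integral>\<^sup>+p. (ennreal (sqrt (W p) * N p))\<^sup>2 \<partial>?L) * (\<integral>\<^sup>+p. (ennreal (sqrt (W p) * D p))\<^sup>2 \<partial>?L)"
    by (rule Cauchy_Schwarz_nn_integral) measurable
  also have "(\<integral>\<^sup>+p. (ennreal (sqrt (W p) * N p))\<^sup>2 \<partial>?L) = (\<integral>\<^sup>+p. ennreal (W p * (N p)\<^sup>2) \<partial>?L)"
    using nn by (intro nn_integral_cong) (simp add: ennreal_power power_mult_distrib)
  also have "\<dots> = ennreal (\<Sum>x\<in>P. \<Sum>y\<in>P. w x * w y * (r\<^sup>2/4 + (norm (x - y))\<^sup>2) powr (-(real DIM('a) - 1)/2))"
    unfolding W_def N_def using line_kernel_sum_L2[where P=P and w=w, OF assms(1,2) c(1,2)] unfolding c(5) .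
  also have "(\<integral>\<^sup>+p. (ennreal (sqrt (W p) * D p))\<^sup>2 \<partial>?L) = (\<integral>\<^sup>+p. ennreal (W p * (D p)\<^sup>2) \<partial>?L)"
    using nn by (intro nn_integral_cong) (simp add: ennreal_power power_mult_distrib)
  also have "\<dots> \<le> ennreal ((real DIM('a) - 1) * 4 powr ((real DIM('a) + 1 - s)/2) * (r\<^sup>2) powr ((s - (real DIM('a) - 1))/2)) * energy s \<mu>"
    unfolding W_def D_def power2_abs using r2 assms by (intro smoothing_difference_L2)
  also have "(r\<^sup>2) powr ((s - (real DIM('a) - 1))/2) = r powr (s - (real DIM('a) - 1))"
  proof -
    have "(r\<^sup>2) powr (E/2) = r powr E" for E
      using assms(3) by (simp add: powr_powr powr_numeral[symmetric] del: powr_numeral)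
    then show ?thesis .
  qed
  finally show ?thesis
    by (simp add: mult_left_mono)
qed

text \<open>Let \<open>\<nu>\<close> be the total Frostman weight on an \<open>r\<close>-net of
  \<open>E\<close>. The lower bound \<open>\<nu> * r powr (\<zeta>/4)\<close> for the weighted sum
  of oscillations, squared, is at most a multiple of \<open>\<nu> * r powr \<zeta>\<close>, hence
  \<open>\<nu> = O(r powr (\<zeta>/2))\<close>. The exponent \<open>\<zeta>/4\<close> leaves a
  positive power both in the threshold and in the conclusion, so both are summable over dyadic
  \<open>r\<close>.\<close>

lemma oscillation_content:
  assumes s: "real DIM('a) - 1 < s" "s \<le> real DIM('a) + 1"
    and t: "0 < t" "t < real DIM('a) - 1" "2 * (real DIM('a) - 1) - s < t"
    and en: "energy s \<mu> < \<infinity>"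
  defines "\<zeta> \<equiv> s + t - 2 * (real DIM('a) - 1)"
  obtains C where "C \<ge> 0" "\<And>E r \<delta>. bounded E \<Longrightarrow> 0 < r \<Longrightarrow> r \<le> 1 \<Longrightarrow> 0 < \<delta> \<Longrightarrow>
      (\<And>x. x \<in> E \<Longrightarrow> oscillation r x \<ge> ennreal (r powr (\<zeta>/4))) \<Longrightarrow>
      C * r powr (\<zeta>/2) \<le> \<delta> powr t \<Longrightarrow>
      hausdorff_pre t \<delta> E \<le> ennreal (C * r powr (\<zeta>/2))"
proof -
  define m where "m = real DIM('a) - 1"
  have m: "m > 0" using t unfolding m_def by linarith
  define e where "e = enn2real (energy s \<mu>)"
  have e: "e \<ge> 0" "energy s \<mu> = ennreal e" using en by (auto simp: e_def less_top)
  define C1 where "C1 = m * 4 powr ((m + 2 - s)/2) * e"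
  define C2 where "C2 = 2 powr m / (1 - 2 powr (t - m))"
  have C1: "C1 \<ge> 0" using m e by (simp add: C1_def)
  have "2 powr (t - m) < 1" using t by (auto simp: m_def powr_less_one)
  then have C2: "C2 \<ge> 0" by (simp add: C2_def)
  define C where "C = 12 powr t * (C1 * C2)"
  show ?thesis
  proof (rule that[of C])
    show "C \<ge> 0" using C1 C2 by (simp add: C_def)
    fix E :: "'a set" and r \<delta> :: real
    assume E: "bounded E" and r: "0 < r" "r \<le> 1" and \<delta>: "0 < \<delta>"
      and osc: "\<And>x. x \<in> E \<Longrightarrow> oscillation r x \<ge> ennreal (r powr (\<zeta>/4))"
      and small: "C * r powr (\<zeta>/2) \<le> \<delta> powr t"
    have h1: "compact (closure E)" using E by (simp add: compact_closure)
    have h2: "closure E \<subseteq> (\<Union>p\<in>E. ball p r)"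
    proof
      fix x assume "x \<in> closure E"
      then obtain p where "p \<in> E" "dist p x < r" using r by (auto simp: closure_approachable)
      then show "x \<in> (\<Union>p\<in>E. ball p r)" by auto
    qed
    obtain P where P: "P \<subseteq> E" "finite P" "closure E \<subseteq> (\<Union>p\<in>P. ball p r)"
      by (rule compactE_image[OF h1 open_ball h2])
    have EP: "E \<subseteq> (\<Union>p\<in>P. cball p r)"
    proof
      fix x assume "x \<in> E"
      then have "x \<in> (\<Union>p\<in>P. ball p r)" using P(3) closure_subset by blast
      then show "x \<in> (\<Union>p\<in>P. cball p r)" using ball_subset_cball by blast
    qed
    \<comment> \<open>With \<open>2^J * r\<close> above the diameter of \<open>E\<close>, the dyadic
      scales up to \<open>J\<close> see every pair of points of the net.\<close>
    obtain J where J: "diameter E / r < 2 ^ J" using real_arch_pow[of 2 "diameter E / r"] by auto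
    have diam: "dist x y \<le> 2^J * r" if "x \<in> P" "y \<in> P" for x y
    proof -
      have "dist x y \<le> diameter E" using E P(1) that by (intro diameter_bounded_bound) auto
      also have "\<dots> \<le> 2^J * r" using J r by (simp add: field_simps)
      finally show ?thesis .
    qed
    obtain w where w: "\<And>p. w p \<ge> 0"
      "\<And>x j. x \<in> P \<Longrightarrow> j \<le> J \<Longrightarrow> sum w (P \<inter> cball x (2^j * r)) \<le> (2^j * r) powr t"
      "\<And>E \<delta>. E \<subseteq> (\<Union>p\<in>P. cball p r) \<Longrightarrow> 0 < \<delta> \<Longrightarrow> 12 powr t * sum w P \<le> \<delta> powr t \<Longrightarrow>
         hausdorff_pre t \<delta> E \<le> ennreal (12 powr t * sum w P)"
      by (rule finite_frostman[OF P(2) r(1) t(1), of J]) blast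
    define \<nu> where "\<nu> = sum w P"
    have \<nu>: "\<nu> \<ge> 0" using w by (simp add: \<nu>_def sum_nonneg)
    have "ennreal ((\<nu> * r powr (\<zeta>/4))\<^sup>2) = (\<Sum>x\<in>P. ennreal (w x) * ennreal (r powr (\<zeta>/4)))\<^sup>2"
      using w \<nu> by (simp add: \<nu>_def sum_distrib_right ennreal_mult[symmetric] sum_ennreal ennreal_power sum_nonneg)
    also have "\<dots> \<le> (\<Sum>x\<in>P. ennreal (w x) * oscillation r x)\<^sup>2"
      using P(1) osc by (intro power_mono sum_mono mult_left_mono) auto
    also have "\<dots> \<le> ennreal (\<Sum>x\<in>P. \<Sum>y\<in>P. w x * w y * (r\<^sup>2/4 + (norm (x - y))\<^sup>2) powr (-m/2))
      * (ennreal (m * 4 powr ((real DIM('a) + 1 - s)/2) * r powr (s - m)) * energy s \<mu>)"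
      unfolding m_def using s m by (intro oscillation_sum_le P w r) (auto simp: m_def)
    also have "\<dots> \<le> ennreal (C2 * r powr (t - m) * \<nu>) * (ennreal (m * 4 powr ((real DIM('a) + 1 - s)/2) * r powr (s - m)) * energy s \<mu>)"
      unfolding C2_def \<nu>_def using m t
      by (intro mult_right_mono ennreal_leI discrete_energy_le[where J=J] P r w diam) (auto simp: m_def)
    also have "\<dots> = ennreal (C2 * r powr (t - m) * \<nu> * (C1 * r powr (s - m)))"
    proof -
      have "ennreal (m * 4 powr ((real DIM('a) + 1 - s)/2) * r powr (s - m)) * energy s \<mu> = ennreal (C1 * r powr (s - m))"
        unfolding e(2) C1_def using m e(1) by (simp add: ennreal_mult[symmetric] m_def ac_simps)
      then show ?thesis using C1 C2 \<nu> by (simp add: ennreal_mult[symmetric])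
    qed
    finally have "(\<nu> * r powr (\<zeta>/4))\<^sup>2 \<le> C2 * r powr (t - m) * \<nu> * (C1 * r powr (s - m))"
      using C1 C2 \<nu> by (subst (asm) ennreal_le_iff) auto
    also have "\<dots> = (C1 * C2) * (r powr (t - m) * r powr (s - m)) * \<nu>" by simp
    also have "r powr (t - m) * r powr (s - m) = r powr (\<zeta>/2) * r powr (\<zeta>/2)"
    proof -
      have "(t - m) + (s - m) = \<zeta>/2 + \<zeta>/2" by (simp add: \<zeta>_def m_def)
      then show ?thesis by (simp only: powr_add[symmetric])
    qed
    also have "(\<nu> * r powr (\<zeta>/4))\<^sup>2 = \<nu> * r powr (\<zeta>/2) * \<nu>"
      by (simp add: power2_eq_square powr_add[symmetric] mult.assoc mult.left_commute)
    finally have *: "(r powr (\<zeta>/2) * \<nu>) * \<nu> \<le> (r powr (\<zeta>/2) * \<nu>) * ((C1 * C2) * r powr (\<zeta>/2))"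
      by (simp add: ac_simps)
    have "\<nu> \<le> (C1 * C2) * r powr (\<zeta>/2)"
    proof (cases "\<nu> = 0")
      case True
      then show ?thesis using C1 C2 by simp
    next
      case False
      then have "r powr (\<zeta>/2) * \<nu> > 0" using \<nu> r by simp
      then show ?thesis using * by (simp only: mult_le_cancel_left_pos)
    qed
    then have b: "12 powr t * \<nu> \<le> C * r powr (\<zeta>/2)"
      unfolding C_def mult.assoc by (intro mult_left_mono) auto
    have "hausdorff_pre t \<delta> E \<le> ennreal (12 powr t * \<nu>)"
      unfolding \<nu>_def using b small by (intro w(3)[OF EP \<delta>]) (simp add: \<nu>_def)
    also have "\<dots> \<le> ennreal (C * r powr (\<zeta>/2))" using b by (rule ennreal_leI)
    finally show "hausdorff_pre t \<delta> E \<le> ennreal (C * r powr (\<zeta>/2))" .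
  qed
qed

end

subsection \<open>Neighbourhoods of null cones\<close>

text \<open>The vector on the right is \<open>norm v\<close> times the component of \<open>u\<close>
  orthogonal to \<open>v\<close>. It is linear in \<open>u\<close>, so the square root of
  \<open>gram u v\<close> is a seminorm in \<open>u\<close> and satisfies a reverse triangle
  inequality.\<close>

lemma gram_eq_norm:
  fixes u v :: "'a::real_inner"
  assumes "v \<noteq> 0"
  shows "gram u v = (norm (norm v *\<^sub>R u - ((u \<bullet> v) / norm v) *\<^sub>R v))\<^sup>2"
proof -
  have "(norm (norm v *\<^sub>R u - ((u \<bullet> v) / norm v) *\<^sub>R v))\<^sup>2
      = (norm v)\<^sup>2 * (norm u)\<^sup>2 - 2 * (u \<bullet> v)\<^sup>2 + (u \<bullet> v)\<^sup>2 / (norm v)\<^sup>2 * (v \<bullet> v)"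
    using assms unfolding power2_norm_eq_inner[of "_ - _"]
    by (simp add: inner_diff_left inner_diff_right inner_commute power2_eq_square
        power2_norm_eq_inner[unfolded power2_eq_square] field_simps)
  also have "\<dots> = gram u v"
    using assms by (simp add: gram_def power2_norm_eq_inner[symmetric] mult.commute)
  finally show ?thesis ..
qed

lemma sqrt_gram_diff_ge:
  fixes e f v :: "'a::real_inner"
  shows "sqrt (gram e v) \<ge> sqrt (gram f v) - norm (e - f) * norm v"
proof (cases "v = 0")
  case False
  define Q where "Q = (\<lambda>u. norm v *\<^sub>R u - ((u \<bullet> v) / norm v) *\<^sub>R v)"
  have Q: "sqrt (gram u v) = norm (Q u)" for u
    using gram_eq_norm[OF False] by (simp add: Q_def)
  have "Q f = Q e - Q (e - f)"
    by (simp add: Q_def algebra_simps inner_diff_left diff_divide_distrib)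
  then have "norm (Q f) \<le> norm (Q e) + norm (Q (e - f))"
    using norm_triangle_ineq4 by metis
  moreover have "norm (Q (e - f)) \<le> norm (e - f) * norm v"
    unfolding Q[symmetric] by (rule real_le_lsqrt) (simp_all add: gram_def power_mult_distrib)
  ultimately show ?thesis by (simp add: Q)
qed (simp add: gram_def)

text \<open>On this cone around the line spanned by \<open>e\<close>, the exponent
  \<open>(norm v)\<^sup>2 / 2 + gram e v / (2 * \<rho>\<^sup>2)\<close> is at most
  \<open>(norm v)\<^sup>2\<close>. The weight is therefore dominated by an anisotropic Gaussian,
  whose integral is explicit.\<close>

lemma gauss_measure_cone_le:
  fixes e :: "'a::euclidean_space"
  assumes "norm e = 1" "\<rho> > 0"
  shows "(\<integral>\<^sup>+v. ennreal (gauss_weight v) * indicator {v. gram e v < \<rho>\<^sup>2 * (norm v)\<^sup>2} v \<partial>lborel)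
    \<le> ennreal (2 powr (real DIM('a)/2) * \<rho> powr (real DIM('a) - 1))"
proof -
  define m where "m = real DIM('a) - 1"
  have m: "m \<ge> 0" unfolding m_def using DIM_positive[where 'a='a] by linarith
  define l where "l = 1/2 + 1 / (2 * \<rho>\<^sup>2)"
  define p where "p = (1 / (sqrt 2 * \<rho>)) *\<^sub>R e"
  have np: "(norm p)\<^sup>2 = 1 / (2 * \<rho>\<^sup>2)"
    using assms by (simp add: p_def power_mult_distrib power_divide)
  have lp: "(norm p)\<^sup>2 < l" "l - (norm p)\<^sup>2 = 1/2"
    by (auto simp: np l_def)
  have ip: "(v \<bullet> p)\<^sup>2 = (e \<bullet> v)\<^sup>2 / (2 * \<rho>\<^sup>2)" for v
    using assms by (simp add: p_def power_mult_distrib power_divide inner_commute)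
  have "(\<integral>\<^sup>+v. ennreal (gauss_weight v) * indicator {v. gram e v < \<rho>\<^sup>2 * (norm v)\<^sup>2} v \<partial>lborel)
      \<le> (\<integral>\<^sup>+v. ennreal (exp (- (pi * (l * (norm v)\<^sup>2 - (v \<bullet> p)\<^sup>2)))) \<partial>lborel)"
  proof (rule nn_integral_mono)
    fix v :: 'a
    have q: "l * (norm v)\<^sup>2 - (v \<bullet> p)\<^sup>2 = (norm v)\<^sup>2 / 2 + gram e v / (2 * \<rho>\<^sup>2)"
      using assms by (simp add: l_def ip gram_def field_simps)
    have "l * (norm v)\<^sup>2 - (v \<bullet> p)\<^sup>2 \<le> (norm v)\<^sup>2" if "gram e v < \<rho>\<^sup>2 * (norm v)\<^sup>2"
    proof -
      have "gram e v / (2 * \<rho>\<^sup>2) \<le> (\<rho>\<^sup>2 * (norm v)\<^sup>2) / (2 * \<rho>\<^sup>2)"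
        using that by (intro divide_right_mono) auto
      also have "\<dots> = (norm v)\<^sup>2 / 2" using assms by simp
      finally show ?thesis unfolding q by linarith
    qed
    then show "ennreal (gauss_weight v) * indicator {v. gram e v < \<rho>\<^sup>2 * (norm v)\<^sup>2} v
       \<le> ennreal (exp (- (pi * (l * (norm v)\<^sup>2 - (v \<bullet> p)\<^sup>2))))"
      by (auto simp: gauss_weight_def indicator_def intro!: ennreal_leI)
  qed
  also have "\<dots> = ennreal (l powr (-m/2) * (1/2) powr (-1/2))"
    using nn_integral_anisotropic_gaussian[OF lp(1)] unfolding lp(2) m_def .
  also have "\<dots> \<le> ennreal (2 powr (real DIM('a)/2) * \<rho> powr m)"
  proof (rule ennreal_leI)
    have "l powr (-m/2) \<le> (1 / (2 * \<rho>\<^sup>2)) powr (-m/2)"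
      using assms m by (intro powr_mono2') (auto simp: l_def)
    also have "\<dots> = (2 * \<rho>\<^sup>2) powr (m/2)"
      using assms by (simp add: powr_divide powr_minus)
    also have "\<dots> = 2 powr (m/2) * \<rho> powr m"
      using assms by (simp add: powr_mult powr_powr powr_numeral[symmetric] del: powr_numeral)
    finally have "l powr (-m/2) * (1/2) powr (-1/2) \<le> (2 powr (m/2) * \<rho> powr m) * (1/2) powr (-1/2)"
      by (intro mult_right_mono) auto
    also have "(2 powr (m/2) * \<rho> powr m) * (1/2) powr (-1/2) = (2 powr (m/2) * 2 powr (1/2)) * \<rho> powr m"
      by (simp add: powr_divide powr_minus)
    also have "2 powr (m/2) * 2 powr (1/2) = (2::real) powr (real DIM('a)/2)"
    proof -
      have "m/2 + 1/2 = real DIM('a)/2" by (simp add: m_def field_simps)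
      then show ?thesis by (simp only: powr_add[symmetric])
    qed
    finally show "l powr (-m/2) * (1/2) powr (-1/2) \<le> 2 powr (real DIM('a)/2) * \<rho> powr m" .
  qed
  finally show ?thesis by (simp add: m_def)
qed

text \<open>A cover of \<open>A\<close> by sets of diameter \<open>d i\<close> gives cones of
  aperture \<open>\<rho> i > d i\<close> around one point of \<open>A\<close> in each set that meets
  \<open>A\<close>. The slack \<open>\<rho> i - d i\<close> keeps the points of \<open>A\<close> in
  that set away from the complement of \<open>U\<close>; \<open>\<eta>\<close> may depend on
  \<open>e\<close>.\<close>

lemma null_cone_neighbourhood:
  fixes A :: "'a::euclidean_space set"
  assumes "DIM('a) \<ge> 2" "A \<subseteq> sphere 0 1" "hausdorff_measure (real DIM('a) - 1) A = 0" "0 < \<epsilon>"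
  obtains U where "U \<in> sets borel"
    "(\<integral>\<^sup>+v. ennreal (gauss_weight v) * indicator U v \<partial>lborel) \<le> ennreal \<epsilon>"
    "\<And>e. e \<in> A \<Longrightarrow> \<exists>\<eta>>0. \<forall>v. v \<notin> U \<longrightarrow> \<eta> * (norm v)\<^sup>2 \<le> gram e v"
proof -
  define m where "m = real DIM('a) - 1"
  have m: "m > 0" unfolding m_def using assms(1) by linarith
  \<comment> \<open>The covering sum and the sum of the enlargements are each at most
    \<open>\<gamma>\<close>, and \<open>2 * \<gamma>\<close> times the constant of
    \<open>gauss_measure_cone_le\<close> is \<open>\<epsilon>\<close>.\<close>
  define \<gamma> where "\<gamma> = \<epsilon> / (2 * 2 powr (real DIM('a)/2))"
  have \<gamma>: "\<gamma> > 0" using assms by (simp add: \<gamma>_def)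
  obtain C where C: "A \<subseteq> (\<Union>i::nat. C i)" "\<And>i. bounded (C i)"
      "(\<Sum>i. ennreal (diameter (C i) powr m)) < ennreal \<gamma>"
    using hausdorff_null_cover[OF assms(3), of 1 "ennreal \<gamma>"] \<gamma> unfolding m_def by (metis ennreal_less_zero_iff zero_less_one)
  define d where "d = (\<lambda>i. diameter (C i))"
  have d0: "d i \<ge> 0" for i unfolding d_def by (rule diameter_ge_0[OF C(2)])
  \<comment> \<open>The enlargement is made in the \<open>m\<close>-th power so that it sums to
    \<open>\<gamma>\<close>; it also makes \<open>\<rho> i\<close> positive for sets of diameter
    0.\<close>
  define \<rho> where "\<rho> = (\<lambda>i. (d i powr m + \<gamma> * (1/2) ^ Suc i) powr (1/m))"
  have \<rho>m: "\<rho> i powr m = d i powr m + \<gamma> * (1/2) ^ Suc i" for i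
    using m \<gamma> by (simp add: \<rho>_def powr_powr add_nonneg_pos)
  have \<rho>d: "d i < \<rho> i" for i
  proof (rule ccontr)
    assume "\<not> d i < \<rho> i"
    then have "\<rho> i powr m \<le> d i powr m" using m by (intro powr_mono2) (auto simp: \<rho>_def)
    moreover have "\<gamma> * (1/2) ^ Suc i > 0" using \<gamma> by simp
    ultimately show False unfolding \<rho>m by linarith
  qed
  define e where "e = (\<lambda>i. SOME x. x \<in> A \<inter> C i)"
  have e: "e i \<in> A \<inter> C i" if "A \<inter> C i \<noteq> {}" for i
    unfolding e_def using that by (metis ex_in_conv someI_ex)
  define V where "V = (\<lambda>i. if A \<inter> C i = {} then {} else {v. gram (e i) v < (\<rho> i)\<^sup>2 * (norm v)\<^sup>2})"
  have [measurable]: "V i \<in> sets borel" for i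
    unfolding V_def by auto
  have Vi: "(\<integral>\<^sup>+v. ennreal (gauss_weight v) * indicator (V i) v \<partial>lborel) \<le> ennreal (2 powr (real DIM('a)/2)) * ennreal (\<rho> i powr m)" for i
  proof (cases "A \<inter> C i = {}")
    case False
    then have "norm (e i) = 1" using e[OF False] assms(2) by auto
    from gauss_measure_cone_le[OF this, of "\<rho> i"] show ?thesis
      using False \<rho>d[of i] d0[of i] by (simp add: V_def m_def ennreal_mult[symmetric])
  qed (simp add: V_def)
  show ?thesis
  proof (rule that[of "\<Union>i. V i"])
    show "(\<Union>i. V i) \<in> sets borel" by measurable
    have "(\<integral>\<^sup>+v. ennreal (gauss_weight v) * indicator (\<Union>i. V i) v \<partial>lborel)
       \<le> (\<integral>\<^sup>+v. (\<Sum>i. ennreal (gauss_weight v) * indicator (V i) v) \<partial>lborel)"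
    proof (rule nn_integral_mono)
      fix v :: 'a
      show "ennreal (gauss_weight v) * indicator (\<Union>i. V i) v \<le> (\<Sum>i. ennreal (gauss_weight v) * indicator (V i) v)"
      proof (cases "v \<in> (\<Union>i. V i)")
        case True
        then obtain i where "v \<in> V i" by blast
        then have "ennreal (gauss_weight v) * indicator (\<Union>i. V i) v = (\<Sum>j\<in>{i}. ennreal (gauss_weight v) * indicator (V j) v)"
          using True by simp
        also have "\<dots> \<le> (\<Sum>i. ennreal (gauss_weight v) * indicator (V i) v)"
          by (rule sum_le_suminf) auto
        finally show ?thesis .
      qed simp
    qed
    also have "\<dots> = (\<Sum>i. \<integral>\<^sup>+v. ennreal (gauss_weight v) * indicator (V i) v \<partial>lborel)"
      by (rule nn_integral_suminf) measurable
    also have "\<dots> \<le> (\<Sum>i. ennreal (2 powr (real DIM('a)/2)) * ennreal (\<rho> i powr m))"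
      by (intro suminf_le Vi) auto
    also have "\<dots> = ennreal (2 powr (real DIM('a)/2)) * (\<Sum>i. ennreal (\<rho> i powr m))"
      by simp
    also have "(\<Sum>i. ennreal (\<rho> i powr m)) = (\<Sum>i. ennreal (d i powr m)) + (\<Sum>i. ennreal (\<gamma> * (1/2) ^ Suc i))"
      unfolding \<rho>m using \<gamma> by (subst suminf_add) auto
    also have "(\<Sum>i. ennreal (\<gamma> * (1/2) ^ Suc i)) = ennreal \<gamma>"
    proof -
      have "(\<lambda>i. \<gamma> * (1/2) ^ Suc i) sums (\<gamma> * 1)"
        by (intro sums_mult power_half_series)
      then show ?thesis
        using \<gamma> by (intro suminf_ennreal_eq) auto
    qed
    also have "ennreal (2 powr (real DIM('a)/2)) * ((\<Sum>i. ennreal (d i powr m)) + ennreal \<gamma>)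
        \<le> ennreal (2 powr (real DIM('a)/2)) * (ennreal \<gamma> + ennreal \<gamma>)"
      using C(3) unfolding d_def by (intro mult_left_mono add_right_mono) auto
    also have "\<dots> = ennreal \<epsilon>"
      using \<gamma> by (simp add: ennreal_plus[symmetric] ennreal_mult[symmetric] \<gamma>_def del: ennreal_plus)
    finally show "(\<integral>\<^sup>+v. ennreal (gauss_weight v) * indicator (\<Union>i. V i) v \<partial>lborel) \<le> ennreal \<epsilon>" .
    fix x assume x: "x \<in> A"
    then obtain i where i: "x \<in> C i" using C(1) by blast
    then have ne: "A \<inter> C i \<noteq> {}" using x by blast
    have "dist x (e i) \<le> d i"
      unfolding d_def using e[OF ne] i C(2) by (intro diameter_bounded_bound) auto
    then have xe: "norm (x - e i) \<le> d i" by (simp add: dist_norm)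
    show "\<exists>\<eta>>0. \<forall>v. v \<notin> (\<Union>i. V i) \<longrightarrow> \<eta> * (norm v)\<^sup>2 \<le> gram x v"
    proof (intro exI[of _ "(\<rho> i - d i)\<^sup>2"] conjI allI impI)
      show "0 < (\<rho> i - d i)\<^sup>2" using \<rho>d[of i] by simp
      fix v assume "v \<notin> (\<Union>i. V i)"
      then have "(\<rho> i)\<^sup>2 * (norm v)\<^sup>2 \<le> gram (e i) v" using ne by (auto simp: V_def not_less split: if_splits)
      then have "\<rho> i * norm v \<le> sqrt (gram (e i) v)"
        by (intro real_le_rsqrt) (simp add: power_mult_distrib)
      moreover have "norm (x - e i) * norm v \<le> d i * norm v" using xe by (intro mult_right_mono) auto
      ultimately have "(\<rho> i - d i) * norm v \<le> sqrt (gram x v)"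
        using sqrt_gram_diff_ge[of "e i" v x] by (simp add: left_diff_distrib)
      then have "((\<rho> i - d i) * norm v)\<^sup>2 \<le> (sqrt (gram x v))\<^sup>2"
        using \<rho>d[of i] by (intro power_mono) auto
      then show "(\<rho> i - d i)\<^sup>2 * (norm v)\<^sup>2 \<le> gram x v"
        by (simp add: power_mult_distrib gram_nonneg)
    qed
  qed
qed

subsection \<open>Absolute continuity from summable oscillation\<close>

text \<open>Outside \<open>U\<close> the exponent grows at least like
  \<open>(norm v)\<^sup>2 / a\<close>. With \<open>d\<close> the dimension, the factor
  \<open>a powr (-(d - 1)/2)\<close> meets a Gaussian integral of order \<open>a powr (d/2)\<close>,
  which leaves \<open>sqrt a\<close>.\<close>

lemma line_kernel_mass_outside_cone_le:
  fixes e :: "'a::euclidean_space"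
  assumes "0 < a" "0 < \<eta>" "0 < c" "U \<in> sets borel" "\<And>v. v \<notin> U \<Longrightarrow> \<eta> * (norm v)\<^sup>2 \<le> gram e v"
  shows "(\<integral>\<^sup>+v. ennreal (gauss_weight v * line_kernel a v (c *\<^sub>R e)) * indicator (- U) v \<partial>lborel)
    \<le> ennreal (sqrt a * (c\<^sup>2 * \<eta>) powr (-(real DIM('a))/2))"
proof -
  define m where "m = real DIM('a) - 1"
  define b where "b = c\<^sup>2 * \<eta> / a"
  have b: "b > 0" using assms by (simp add: b_def)
  have "(\<integral>\<^sup>+v. ennreal (gauss_weight v * line_kernel a v (c *\<^sub>R e)) * indicator (- U) v \<partial>lborel)
     \<le> (\<integral>\<^sup>+v. ennreal (a powr (-m/2)) * ennreal (exp (- (pi * b * (norm (v - (0::'a)))\<^sup>2))) \<partial>lborel)"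
  proof (rule nn_integral_mono)
    fix v :: 'a
    have "gauss_weight v * line_kernel a v (c *\<^sub>R e) \<le> a powr (-m/2) * exp (- (pi * b * (norm (v - (0::'a)))\<^sup>2))" if "v \<notin> U"
    proof -
      have "gram (c *\<^sub>R e) v = c\<^sup>2 * gram e v"
        by (simp add: gram_def power_mult_distrib right_diff_distrib)
      then have "b * (norm v)\<^sup>2 \<le> gram (c *\<^sub>R e) v / a"
        using assms(5)[OF that] assms(1,3) by (simp add: b_def field_simps)
      then have "pi * (b * (norm v)\<^sup>2) \<le> pi * (gram (c *\<^sub>R e) v / a)"
        by (intro mult_left_mono) auto
      then have "exp (- (pi * (gram (c *\<^sub>R e) v / a))) \<le> exp (- (pi * b * (norm (v - (0::'a)))\<^sup>2))"
        by (simp only: diff_zero mult.assoc exp_le_cancel_iff neg_le_iff_le)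
      then have 1: "line_kernel a v (c *\<^sub>R e) \<le> a powr (-m/2) * exp (- (pi * b * (norm (v - (0::'a)))\<^sup>2))"
        unfolding line_kernel_def m_def by (intro mult_left_mono) auto
      have "gauss_weight v \<le> 1" by (simp add: gauss_weight_def)
      then have "gauss_weight v * line_kernel a v (c *\<^sub>R e) \<le> 1 * line_kernel a v (c *\<^sub>R e)"
        by (intro mult_right_mono) auto
      then show ?thesis using 1 by linarith
    qed
    then show "ennreal (gauss_weight v * line_kernel a v (c *\<^sub>R e)) * indicator (- U) v
       \<le> ennreal (a powr (-m/2)) * ennreal (exp (- (pi * b * (norm (v - (0::'a)))\<^sup>2)))"
      by (auto simp: indicator_def ennreal_mult[symmetric] intro!: ennreal_leI)
  qed
  also have "\<dots> = ennreal (a powr (-m/2) * b powr (-(real DIM('a))/2))"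
    by (subst nn_integral_cmult, measurable, subst nn_integral_gaussian[OF b]) (simp add: ennreal_mult)
  also have "a powr (-m/2) * b powr (-(real DIM('a))/2) = sqrt a * (c\<^sup>2 * \<eta>) powr (-(real DIM('a))/2)"
  proof -
    define E where "E = -(real DIM('a))/2"
    have "b powr E = (c\<^sup>2 * \<eta>) powr E * a powr (- E)"
      using assms by (simp add: b_def powr_divide powr_minus divide_simps)
    moreover have "a powr (-m/2) * a powr (- E) = sqrt a"
    proof -
      have "-m/2 + - E = 1/2" by (simp add: E_def m_def field_simps)
      then show ?thesis using assms(1) by (simp only: powr_add[symmetric] powr_half_sqrt less_imp_le)
    qed
    ultimately show ?thesis by (simp add: E_def ac_simps)
  qed
  finally show ?thesis .
qed

text \<open>As the scale tends to 0, the total mass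
  \<open>(a k + (norm u)\<^sup>2) powr (-m/2)\<close> converges while the mass outside
  \<open>U\<close> vanishes, so the whole limit is carried by \<open>U\<close>.\<close>

lemma line_kernel_mass_in_cone_liminf:
  fixes u :: "'a::euclidean_space"
  assumes "u \<noteq> 0" "U \<in> sets borel" "0 < \<eta>"
    "\<And>v. v \<notin> U \<Longrightarrow> \<eta> * (norm v)\<^sup>2 \<le> gram ((1 / norm u) *\<^sub>R u) v"
    and a: "\<And>k. 0 < a k" "a \<longlonglongrightarrow> 0"
  shows "ennreal (norm u powr (-(real DIM('a) - 1)))
    \<le> liminf (\<lambda>k. \<integral>\<^sup>+v. ennreal (gauss_weight v * line_kernel (a k) v u) * indicator U v \<partial>lborel)"
proof -
  define m where "m = real DIM('a) - 1"
  define K where "K = ((norm u)\<^sup>2 * \<eta>) powr (-(real DIM('a))/2)"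
  define G where "G = (\<lambda>k. (a k + (norm u)\<^sup>2) powr (-m/2) - sqrt (a k) * K)"
  have nu: "norm u > 0" using assms(1) by simp
  have "G \<longlonglongrightarrow> (0 + (norm u)\<^sup>2) powr (-m/2) - sqrt 0 * K"
    unfolding G_def using nu by (intro tendsto_intros a(2)) auto
  then have "G \<longlonglongrightarrow> norm u powr (-m)"
    using nu by (simp add: powr_powr powr_numeral[symmetric] del: powr_numeral)
  then have lim: "(\<lambda>k. ennreal (G k)) \<longlonglongrightarrow> ennreal (norm u powr (-m))"
    by (rule tendsto_ennrealI)
  have "ennreal (G k) \<le> (\<integral>\<^sup>+v. ennreal (gauss_weight v * line_kernel (a k) v u) * indicator U v \<partial>lborel)" for k
  proof -
    let ?I = "\<lambda>S. \<integral>\<^sup>+v. ennreal (gauss_weight v * line_kernel (a k) v u) * indicator S v \<partial>lborel"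
    have out: "?I (- U) \<le> ennreal (sqrt (a k) * K)"
      using line_kernel_mass_outside_cone_le[OF a(1) assms(3) nu assms(2,4), of k] nu by (simp add: K_def)
    have "ennreal ((a k + (norm u)\<^sup>2) powr (-m/2)) = (\<integral>\<^sup>+v. ennreal (gauss_weight v * line_kernel (a k) v u) \<partial>lborel)"
      using line_kernel_gauss_integral[OF a(1), of k u] by (simp add: m_def)
    also have "\<dots> = (\<integral>\<^sup>+v. ennreal (gauss_weight v * line_kernel (a k) v u) * indicator U v
         + ennreal (gauss_weight v * line_kernel (a k) v u) * indicator (- U) v \<partial>lborel)"
      by (intro nn_integral_cong) (simp split: split_indicator)
    also have "\<dots> = ?I U + ?I (- U)"
      using assms(2) by (intro nn_integral_add) auto
    also have "\<dots> \<le> ?I U + ennreal (sqrt (a k) * K)"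
      by (intro add_left_mono out)
    finally have *: "ennreal ((a k + (norm u)\<^sup>2) powr (-m/2)) \<le> ?I U + ennreal (sqrt (a k) * K)" .
    have "ennreal (G k) = ennreal ((a k + (norm u)\<^sup>2) powr (-m/2)) - ennreal (sqrt (a k) * K)"
      unfolding G_def using a(1)[of k] by (intro ennreal_minus[symmetric]) (simp add: K_def)
    also have "\<dots> \<le> ?I U"
      using * by (simp add: ennreal_minus_le_iff add.commute)
    finally show ?thesis .
  qed
  then have "liminf (\<lambda>k. ennreal (G k)) \<le> liminf (\<lambda>k. \<integral>\<^sup>+v. ennreal (gauss_weight v * line_kernel (a k) v u) * indicator U v \<partial>lborel)"
    by (intro Liminf_mono) auto
  then show ?thesis
    using lim_imp_Liminf[OF _ lim] by (simp add: m_def)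
qed

context finite_euclidean_measure
begin

text \<open>The mass over directions in \<open>U\<close> is small at the coarse scale
  \<open>(1/4)^M\<close> because \<open>U\<close> is small, and passing to finer scales adds at most
  the oscillations from index \<open>M\<close> on. Fatou's lemma in \<open>y\<close> then transfers
  the bound to the limit of vanishing width.\<close>

lemma cone_mass_le:
  assumes U [measurable]: "U \<in> sets borel"
    and \<epsilon>: "(\<integral>\<^sup>+v. ennreal (gauss_weight v) * indicator U v \<partial>lborel) \<le> ennreal \<epsilon>" "0 \<le> \<epsilon>"
    and S [measurable]: "S \<in> sets borel"
    and cone: "\<And>y. y \<in> S \<Longrightarrow> y \<noteq> x \<and> (\<exists>\<eta>>0. \<forall>v. v \<notin> U \<longrightarrow> \<eta> * (norm v)\<^sup>2 \<le> gram (radial_proj x y) v)"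
  shows "(\<integral>\<^sup>+y. ennreal (norm (y - x) powr (-(real DIM('a) - 1))) * indicator S y \<partial>\<mu>)
    \<le> ennreal (((1/4)^M) powr (-(real DIM('a) - 1)/2) * measure \<mu> (space \<mu>) * \<epsilon>) + (\<Sum>j. oscillation ((1/2)^(j + M)) x)"
proof -
  interpret P: pair_sigma_finite lborel \<mu> ..
  define m where "m = real DIM('a) - 1"
  define a where "a = (\<lambda>k::nat. (1/4::real)^k)"
  have a: "0 < a k" for k by (simp add: a_def)
  have a_lim: "a \<longlonglongrightarrow> 0" unfolding a_def by (intro LIMSEQ_power_zero) auto
  define \<Phi> where "\<Phi> = (\<lambda>k. \<integral>\<^sup>+v. ennreal (gauss_weight v * smoothing (a k) v x) * indicator U v \<partial>lborel)"
  have smooth: "(\<integral>\<^sup>+y. (\<integral>\<^sup>+v. ennreal (gauss_weight v * line_kernel (a k) v (y - x)) * indicator U v \<partial>lborel) \<partial>\<mu>) = \<Phi> k" for k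
  proof -
    have "(\<integral>\<^sup>+y. (\<integral>\<^sup>+v. ennreal (gauss_weight v * line_kernel (a k) v (y - x)) * indicator U v \<partial>lborel) \<partial>\<mu>)
       = (\<integral>\<^sup>+v. (\<integral>\<^sup>+y. ennreal (gauss_weight v * line_kernel (a k) v (y - x)) * indicator U v \<partial>\<mu>) \<partial>lborel)"
      by (rule P.Fubini') measurable
    also have "\<dots> = (\<integral>\<^sup>+v. (\<integral>\<^sup>+y. (ennreal (gauss_weight v) * indicator U v) * ennreal (line_kernel (a k) v (x - y)) \<partial>\<mu>) \<partial>lborel)"
      using line_kernel_minus[of "a k" _ "x - _"] by (intro nn_integral_cong) (simp add: ennreal_mult ac_simps)
    also have "\<dots> = \<Phi> k"
      unfolding \<Phi>_def
      by (intro nn_integral_cong) (simp add: nn_integral_cmult ennreal_smoothing[symmetric] a ennreal_mult ac_simps)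
    finally show ?thesis .
  qed
  have step: "\<Phi> (Suc k) \<le> \<Phi> k + oscillation ((1/2)^k) x" for k
  proof -
    have r: "((1/2)^k)\<^sup>2 = a k" "((1/2)^k)\<^sup>2/4 = a (Suc k)"
      by (simp_all add: a_def power_mult[symmetric] power_even_eq[symmetric] power_divide flip: power_mult)
        (simp_all add: power_mult mult.commute[of k 2])
    have "\<Phi> (Suc k) \<le> (\<integral>\<^sup>+v. ennreal (gauss_weight v * smoothing (a k) v x) * indicator U v
        + ennreal (gauss_weight v * \<bar>smoothing (a (Suc k)) v x - smoothing (a k) v x\<bar>) \<partial>lborel)"
      unfolding \<Phi>_def
    proof (rule nn_integral_mono)
      fix v :: 'a
      have "gauss_weight v * smoothing (a (Suc k)) v x \<le> gauss_weight v * (smoothing (a k) v x + \<bar>smoothing (a (Suc k)) v x - smoothing (a k) v x\<bar>)"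
        by (intro mult_left_mono) auto
      then have "ennreal (gauss_weight v * smoothing (a (Suc k)) v x)
         \<le> ennreal (gauss_weight v * smoothing (a k) v x) + ennreal (gauss_weight v * \<bar>smoothing (a (Suc k)) v x - smoothing (a k) v x\<bar>)"
        by (simp add: distrib_left ennreal_plus[symmetric] ennreal_leI del: ennreal_plus)
      then show "ennreal (gauss_weight v * smoothing (a (Suc k)) v x) * indicator U v
         \<le> ennreal (gauss_weight v * smoothing (a k) v x) * indicator U v + ennreal (gauss_weight v * \<bar>smoothing (a (Suc k)) v x - smoothing (a k) v x\<bar>)"
        by (auto split: split_indicator)
    qed
    also have "\<dots> = \<Phi> k + oscillation ((1/2)^k) x"
      unfolding \<Phi>_def oscillation_def r(2) unfolding r(1) by (rule nn_integral_add) measurable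
    finally show ?thesis .
  qed
  have steps: "\<Phi> (n + M) \<le> \<Phi> M + (\<Sum>j<n. oscillation ((1/2)^(j + M)) x)" for n
  proof (induction n)
    case (Suc n)
    have "\<Phi> (Suc n + M) \<le> \<Phi> (n + M) + oscillation ((1/2)^(n + M)) x" using step[of "n + M"] by simp
    also have "\<dots> \<le> (\<Phi> M + (\<Sum>j<n. oscillation ((1/2)^(j + M)) x)) + oscillation ((1/2)^(n + M)) x"
      by (intro add_right_mono Suc)
    finally show ?case by (simp add: add.assoc)
  qed simp
  let ?T = "\<Sum>j. oscillation ((1/2)^(j + M)) x"
  have bound: "\<Phi> (n + M) \<le> \<Phi> M + ?T" for n
  proof -
    have "(\<Sum>j<n. oscillation ((1/2)^(j + M)) x) \<le> ?T" by (rule sum_le_suminf) auto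
    then show ?thesis using steps[of n] by (meson add_left_mono order_trans)
  qed
  have "\<Phi> M \<le> (\<integral>\<^sup>+v. ennreal (a M powr (-m/2) * measure \<mu> (space \<mu>)) * (ennreal (gauss_weight v) * indicator U v) \<partial>lborel)"
    unfolding \<Phi>_def
  proof (rule nn_integral_mono)
    fix v :: 'a
    have "gauss_weight v * smoothing (a M) v x \<le> (a M powr (-m/2) * measure \<mu> (space \<mu>)) * gauss_weight v"
      using mult_left_mono[OF smoothing_le[OF a[of M], of v x] gauss_weight_nonneg[of v]] by (simp add: m_def mult.commute)
    then have "ennreal (gauss_weight v * smoothing (a M) v x) \<le> ennreal (a M powr (-m/2) * measure \<mu> (space \<mu>)) * ennreal (gauss_weight v)"
      by (simp add: ennreal_mult[symmetric] ennreal_leI)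
    then show "ennreal (gauss_weight v * smoothing (a M) v x) * indicator U v
      \<le> ennreal (a M powr (-m/2) * measure \<mu> (space \<mu>)) * (ennreal (gauss_weight v) * indicator U v)"
      by (auto split: split_indicator)
  qed
  also have "\<dots> = ennreal (a M powr (-m/2) * measure \<mu> (space \<mu>)) * (\<integral>\<^sup>+v. ennreal (gauss_weight v) * indicator U v \<partial>lborel)"
    by (rule nn_integral_cmult) measurable
  also have "\<dots> \<le> ennreal (a M powr (-m/2) * measure \<mu> (space \<mu>)) * ennreal \<epsilon>"
    by (intro mult_left_mono \<epsilon>) auto
  also have "\<dots> = ennreal (a M powr (-m/2) * measure \<mu> (space \<mu>) * \<epsilon>)"
    using \<epsilon>(2) by (simp add: ennreal_mult)
  finally have \<Phi>M: "\<Phi> M \<le> ennreal (a M powr (-m/2) * measure \<mu> (space \<mu>) * \<epsilon>)" .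
  let ?F = "\<lambda>n y. \<integral>\<^sup>+v. ennreal (gauss_weight v * line_kernel (a (n + M)) v (y - x)) * indicator U v \<partial>lborel"
  have a_lim': "(\<lambda>n. a (n + M)) \<longlonglongrightarrow> 0" using a_lim by (rule LIMSEQ_ignore_initial_segment)
  have [measurable]: "(\<lambda>y. ?F n y) \<in> borel_measurable \<mu>" for n by measurable
  have "(\<integral>\<^sup>+y. ennreal (norm (y - x) powr (-m)) * indicator S y \<partial>\<mu>) \<le> (\<integral>\<^sup>+y. liminf (\<lambda>n. ?F n y) \<partial>\<mu>)"
  proof (rule nn_integral_mono)
    fix y
    show "ennreal (norm (y - x) powr (-m)) * indicator S y \<le> liminf (\<lambda>n. ?F n y)"
    proof (cases "y \<in> S")
      case True
      then obtain \<eta> where \<eta>: "\<eta> > 0" "\<And>v. v \<notin> U \<Longrightarrow> \<eta> * (norm v)\<^sup>2 \<le> gram (radial_proj x y) v" "y \<noteq> x"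
        using cone by blast
      then show ?thesis
        using line_kernel_mass_in_cone_liminf[OF _ U \<eta>(1), of "y - x" "\<lambda>n. a (n + M)"] a a_lim' True
        unfolding radial_proj_def m_def by simp
    qed simp
  qed
  also have "\<dots> \<le> liminf (\<lambda>n. \<integral>\<^sup>+y. ?F n y \<partial>\<mu>)"
    by (rule nn_integral_liminf) measurable
  also have "\<dots> = liminf (\<lambda>n. \<Phi> (n + M))" unfolding smooth ..
  also have "\<dots> \<le> liminf (\<lambda>n::nat. \<Phi> M + ?T)" by (intro Liminf_mono) (simp add: bound)
  also have "\<dots> = \<Phi> M + ?T" by (simp add: Liminf_const)
  also have "\<dots> \<le> ennreal (a M powr (-m/2) * measure \<mu> (space \<mu>) * \<epsilon>) + ?T" by (intro add_right_mono \<Phi>M)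
  finally show ?thesis by (simp add: a_def m_def)
qed

text \<open>First \<open>M\<close> is chosen to make the tail of the oscillations small; then
  \<open>\<epsilon>\<close> is chosen depending on \<open>M\<close>, to absorb the factor of
  \<open>cone_mass_le\<close> that grows with \<open>M\<close>. The integrand is positive on the
  cone, so a vanishing integral makes the cone null.\<close>

lemma null_cone_if_summable_oscillation:
  assumes "DIM('a) \<ge> 2" "(\<Sum>k. oscillation ((1/2)^k) x) < \<infinity>"
    and A: "A \<in> sets borel" "A \<subseteq> sphere 0 1" "hausdorff_measure (real DIM('a) - 1) A = 0"
  shows "emeasure \<mu> {y. y \<noteq> x \<and> radial_proj x y \<in> A} = 0"
proof -
  define S where "S = {y. y \<noteq> x \<and> radial_proj x y \<in> A}"
  have [measurable]: "radial_proj x \<in> borel_measurable borel"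
    unfolding radial_proj_def by measurable
  have S [measurable]: "S \<in> sets borel"
    unfolding S_def using A(1) by measurable
  let ?I = "\<integral>\<^sup>+y. ennreal (norm (y - x) powr (-(real DIM('a) - 1))) * indicator S y \<partial>\<mu>"
  have eps: "?I \<le> 0 + ennreal \<theta>" if \<theta>: "0 < \<theta>" for \<theta>
  proof -
    have fin: "oscillation ((1/2)^k) x < top" for k
      using assms(2) ennreal_suminf_lessD[of "\<lambda>k. oscillation ((1/2)^k) x" top k] by simp
    define o' where "o' = (\<lambda>k. enn2real (oscillation ((1/2)^k) x))"
    have o': "oscillation ((1/2)^k) x = ennreal (o' k)" "0 \<le> o' k" for k
      using fin[of k] by (auto simp: o'_def)
    have "summable o'"
      using assms(2) o'(2) unfolding o'(1) by (intro summable_suminf_not_top) auto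
    then obtain M where M: "norm (\<Sum>j. o' (j + M)) < \<theta>/2"
      using suminf_exist_split[of "\<theta>/2" o'] \<theta> by auto
    have sM: "summable (\<lambda>j. o' (j + M))" using \<open>summable o'\<close> by (simp add: summable_iff_shift)
    have tail: "(\<Sum>j. oscillation ((1/2)^(j + M)) x) \<le> ennreal (\<theta>/2)"
      unfolding o'(1) using M sM o'(2) by (subst suminf_ennreal2) (auto intro!: ennreal_leI)
    define K where "K = ((1/4)^M) powr (-(real DIM('a) - 1)/2) * measure \<mu> (space \<mu>)"
    have K: "K \<ge> 0" by (simp add: K_def)
    define \<epsilon> where "\<epsilon> = \<theta> / (2 * (K + 1))"
    have \<epsilon>: "\<epsilon> > 0" using K \<theta> by (simp add: \<epsilon>_def)
    obtain U where U: "U \<in> sets borel" "(\<integral>\<^sup>+v. ennreal (gauss_weight v) * indicator U v \<partial>lborel) \<le> ennreal \<epsilon>"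
      "\<And>e. e \<in> A \<Longrightarrow> \<exists>\<eta>>0. \<forall>v. v \<notin> U \<longrightarrow> \<eta> * (norm v)\<^sup>2 \<le> gram e v"
      using null_cone_neighbourhood[OF assms(1) A(2,3) \<epsilon>] by blast
    have "?I \<le> ennreal (K * \<epsilon>) + (\<Sum>j. oscillation ((1/2)^(j + M)) x)"
      unfolding K_def using \<epsilon> U(3) by (intro cone_mass_le[OF U(1,2) _ S]) (auto simp: S_def)
    also have "\<dots> \<le> ennreal (\<theta>/2) + ennreal (\<theta>/2)"
    proof (intro add_mono tail ennreal_leI)
      show "K * \<epsilon> \<le> \<theta>/2" using K \<theta> by (simp add: \<epsilon>_def field_simps)
    qed
    also have "\<dots> = ennreal \<theta>" using \<theta> by (simp add: ennreal_plus[symmetric] del: ennreal_plus)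
    finally show ?thesis by simp
  qed
  have "?I \<le> 0" by (rule ennreal_le_epsilon, rule eps)
  then have "?I = 0" by simp
  then have "AE y in \<mu>. ennreal (norm (y - x) powr (-(real DIM('a) - 1))) * indicator S y = 0"
    by (subst (asm) nn_integral_0_iff_AE) auto
  then have "AE y in \<mu>. y \<notin> S"
    by (rule AE_mp) (auto simp: S_def indicator_def)
  then have "emeasure \<mu> S = 0"
    by (subst (asm) AE_iff_measurable[OF _ refl]) (auto simp: S_def[symmetric] sets_eq_imp_space_eq[OF sets_eq])
  then show ?thesis by (simp add: S_def)
qed

end

subsection \<open>The exceptional set\<close>

text \<open>The complement of the support is covered by open null sets, and the Lindelof property
  reduces these to countably many.\<close>

lemma emeasure_outside_spt:
  fixes \<mu> :: "'a::euclidean_space measure"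
  assumes "sets \<mu> = sets borel"
  shows "emeasure \<mu> (- spt \<mu>) = 0"
proof -
  define F where "F = {B. open B \<and> emeasure \<mu> B = 0}"
  obtain F' where F': "F' \<subseteq> F" "countable F'" "\<Union>F' = \<Union>F"
    using Lindelof[of F] by (auto simp: F_def)
  have "- spt \<mu> \<subseteq> \<Union>F"
    unfolding spt_def F_def by (auto intro: centre_in_ball[THEN iffD2])
  then have "- spt \<mu> \<subseteq> \<Union>F'" using F' by simp
  moreover have "(\<Union>B\<in>F'. B) \<in> null_sets \<mu>"
    using F' assms by (intro null_sets_UN') (auto simp: F_def null_sets_def)
  ultimately have "emeasure \<mu> (- spt \<mu>) \<le> 0"
    by (metis emeasure_mono image_ident null_setsD1 null_setsD2)
  then show ?thesis by simp
qed

context finite_euclidean_measure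
begin

text \<open>An atom would make first the inner and then the outer integral infinite, as the kernel
  is infinite on the diagonal. This disposes of the apex \<open>x\<close>, where the value
  \<open>radial_proj x x = 0\<close> is a mere convention.\<close>

lemma emeasure_singleton_eq_0:
  assumes "energy s \<mu> < \<infinity>"
  shows "emeasure \<mu> {x} = 0"
proof (rule ccontr)
  assume nz: "emeasure \<mu> {x} \<noteq> 0"
  have top: "(\<integral>\<^sup>+y. riesz_kernel s x y \<partial>\<mu>) = \<infinity>"
  proof -
    have "(\<integral>\<^sup>+y. riesz_kernel s x y \<partial>\<mu>) \<ge> (\<integral>\<^sup>+y. \<infinity> * indicator {x} y \<partial>\<mu>)"
      by (intro nn_integral_mono) (auto simp: riesz_kernel_def split: split_indicator)
    moreover have "(\<integral>\<^sup>+y. \<infinity> * indicator {x} y \<partial>\<mu>) = (\<infinity>::ennreal)"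
      using nz by (subst nn_integral_cmult_indicator) (auto simp: ennreal_top_mult sets_eq)
    ultimately show ?thesis by (simp add: top_unique)
  qed
  have "energy s \<mu> \<ge> (\<integral>\<^sup>+z. \<infinity> * indicator {x} z \<partial>\<mu>)"
    unfolding energy_def by (intro nn_integral_mono) (auto simp: top split: split_indicator)
  moreover have "(\<integral>\<^sup>+y. \<infinity> * indicator {x} y \<partial>\<mu>) = (\<infinity>::ennreal)"
    using nz by (subst nn_integral_cmult_indicator) (auto simp: ennreal_top_mult sets_eq)
  ultimately show False using assms by (simp add: top_unique)
qed

lemma ac_sphere_hausdorff_if_summable_oscillation:
  assumes "DIM('a) \<ge> 2" "energy s \<mu> < \<infinity>" "(\<Sum>k. oscillation ((1/2)^k) x) < \<infinity>"
  shows "ac_sphere_hausdorff (distr \<mu> borel (radial_proj x))"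
  unfolding ac_sphere_hausdorff_def
proof (intro ballI impI)
  fix A :: "'a set"
  assume A [measurable]: "A \<in> sets borel" and null: "hausdorff_measure (real DIM('a) - 1) (A \<inter> sphere 0 1) = 0"
  have sp: "space \<mu> = UNIV" using sets_eq_imp_space_eq[OF sets_eq] by simp
  have [measurable]: "radial_proj x \<in> borel_measurable borel"
    unfolding radial_proj_def by measurable
  let ?S = "{y. y \<noteq> x \<and> radial_proj x y \<in> A \<inter> sphere 0 1}"
  have S: "emeasure \<mu> ?S = 0"
    using null by (intro null_cone_if_summable_oscillation assms) auto
  have Sm: "?S \<in> sets borel"
  proof -
    have "?S = (radial_proj x -` (A \<inter> sphere 0 1) \<inter> space borel) - {x}" by auto
    moreover have "radial_proj x -` (A \<inter> sphere 0 1) \<inter> space borel \<in> sets borel"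
      by (rule measurable_sets[where A = borel]) auto
    ultimately show ?thesis by auto
  qed
  have "emeasure (distr \<mu> borel (radial_proj x)) A = emeasure \<mu> (radial_proj x -` A \<inter> space \<mu>)"
    by (rule emeasure_distr) (auto simp: measurable_cong_sets[OF sets_eq refl])
  also have "\<dots> \<le> emeasure \<mu> ({x} \<union> ?S)"
    using Sm sets_eq by (intro emeasure_mono) (auto simp: radial_proj_def)
  also have "\<dots> \<le> emeasure \<mu> {x} + emeasure \<mu> ?S"
    using Sm sets_eq by (intro emeasure_subadditive) auto
  also have "\<dots> = 0" using S emeasure_singleton_eq_0[OF assms(2)] by simp
  finally show "emeasure (distr \<mu> borel (radial_proj x)) A = 0" by simp
qed

section \<open>Energy exponents above the dimension\<close>

lemma near_diagonal_le_energy: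
  assumes "0 < r" "0 \<le> s"
  shows "(\<integral>\<^sup>+x. (\<integral>\<^sup>+y. (if norm (x - y) < r then 1 else 0) \<partial>\<mu>) \<partial>\<mu>) \<le> ennreal (r powr s) * energy s \<mu>"
proof -
  have [measurable]: "(\<lambda>y. riesz_kernel s x y) \<in> borel_measurable \<mu>" for x
    unfolding riesz_kernel_def by measurable
  have [measurable]: "(\<lambda>x. \<integral>\<^sup>+y. riesz_kernel s x y \<partial>\<mu>) \<in> borel_measurable \<mu>"
    unfolding riesz_kernel_def by measurable
  have "(\<integral>\<^sup>+x. (\<integral>\<^sup>+y. (if norm (x - y) < r then 1 else 0) \<partial>\<mu>) \<partial>\<mu>) \<le> (\<integral>\<^sup>+x. (\<integral>\<^sup>+y. ennreal (r powr s) * riesz_kernel s x y \<partial>\<mu>) \<partial>\<mu>)"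
  proof (intro nn_integral_mono)
    fix x y :: 'a
    show "(if norm (x - y) < r then 1 else 0) \<le> ennreal (r powr s) * riesz_kernel s x y"
    proof (cases "norm (x - y) < r \<and> x \<noteq> y")
      case True
      then have "1 \<le> (r / dist x y) powr s"
        using assms by (intro ge_one_powr_ge_zero) (auto simp: dist_norm)
      also have "\<dots> = r powr s * dist x y powr (- s)"
        using assms True by (simp add: powr_divide powr_minus divide_simps)
      finally show ?thesis
        using True by (simp add: riesz_kernel_def ennreal_mult[symmetric])
    next
      case False
      then show ?thesis using assms by (auto simp: riesz_kernel_def ennreal_mult_top)
    qed
  qed
  also have "\<dots> = ennreal (r powr s) * energy s \<mu>"
    unfolding energy_def by (simp add: nn_integral_cmult)
  finally show ?thesis .
qed

text \<open>Let \<open>\<phi> h\<close> be the mass of the ball of radius \<open>r\<close> around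
  \<open>h\<close>. Cauchy-Schwarz on \<open>ball 0 (R + 1)\<close> compares the integral of
  \<open>\<phi>\<close>, which is the total mass times the volume of an \<open>r\<close>-ball, with
  that of its square, which only sees pairs of points at distance below \<open>2 * r\<close> and is
  small by the energy. The squared total mass is thus \<open>O(r powr (s - d))\<close>, with
  \<open>d\<close> the dimension.\<close>

lemma zero_measure_if_energy_above_dimension:
  assumes "0 < R" "emeasure \<mu> (- ball 0 R) = 0" "energy s \<mu> < \<infinity>" "real DIM('a) < s"
  shows "emeasure \<mu> UNIV = 0"
proof -
  interpret P: pair_sigma_finite lborel \<mu> ..
  interpret PM: pair_sigma_finite \<mu> \<mu> ..
  interpret P2: pair_sigma_finite lborel "\<mu> \<Otimes>\<^sub>M \<mu>" ..
  have sp: "space \<mu> = UNIV" using sets_eq_imp_space_eq[OF sets_eq] by simp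
  define \<beta> where "\<beta> = unit_ball_vol (real DIM('a))"
  have \<beta>: "\<beta> > 0" unfolding \<beta>_def by simp
  have vol: "emeasure lborel (ball (c::'a) r) = ennreal (\<beta> * r ^ DIM('a))" if "r \<ge> 0" for c r
    unfolding \<beta>_def using that by (rule emeasure_ball)
  define M where "M = measure \<mu> UNIV"
  have M: "emeasure \<mu> UNIV = ennreal M" "M \<ge> 0"
    using emeasure_eq_measure sp by (auto simp: M_def)
  define e where "e = enn2real (energy s \<mu>)"
  have e: "e \<ge> 0" "energy s \<mu> = ennreal e" using assms(3) by (auto simp: e_def less_top)
  have AEy: "AE y in \<mu>. y \<in> ball 0 R"
    using assms(2) by (intro AE_I[where N="- ball 0 R"]) (auto simp: sets_eq)
  have main: "M\<^sup>2 \<le> ((R + 1) ^ DIM('a) * 2 powr s * e) * r powr (s - real DIM('a))" if r: "0 < r" "r \<le> 1" for r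
  proof -
    let ?i = "\<lambda>(h::'a) y. if norm (h - y) < r then 1 else 0 :: ennreal"
    let ?B = "\<lambda>h::'a. if norm h < R + 1 then 1 else 0 :: ennreal"
    define V where "V = \<beta> * r ^ DIM('a)"
    have V: "V > 0" using \<beta> r by (simp add: V_def)
    define \<phi> where "\<phi> = (\<lambda>h::'a. \<integral>\<^sup>+y. ?i h y \<partial>\<mu>)"
    have [measurable]: "\<phi> \<in> borel_measurable lborel"
      unfolding \<phi>_def by measurable
    have int_i: "(\<integral>\<^sup>+h. ?i h y \<partial>lborel) = ennreal V" for y
    proof -
      have "(\<integral>\<^sup>+h. ?i h y \<partial>lborel) = (\<integral>\<^sup>+h. indicator (ball y r) h \<partial>lborel)"
        by (intro nn_integral_cong) (auto simp: indicator_def dist_norm norm_minus_commute)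
      then show ?thesis using r by (simp add: vol V_def)
    qed
    have "(\<integral>\<^sup>+h. \<phi> h * ?B h \<partial>lborel) = (\<integral>\<^sup>+h. (\<integral>\<^sup>+y. ?i h y * ?B h \<partial>\<mu>) \<partial>lborel)"
      unfolding \<phi>_def by (intro nn_integral_cong nn_integral_multc[symmetric]) measurable
    also have "\<dots> = (\<integral>\<^sup>+y. (\<integral>\<^sup>+h. ?i h y * ?B h \<partial>lborel) \<partial>\<mu>)"
      by (rule P.Fubini'[symmetric]) measurable
    also have "\<dots> = (\<integral>\<^sup>+y. ennreal V \<partial>\<mu>)"
    proof (rule nn_integral_cong_AE, rule AE_mp[OF AEy], intro AE_I2 impI)
      fix y :: 'a assume "y \<in> ball 0 R"
      \<comment> \<open>As \<open>r \<le> 1\<close>, balls of radius \<open>r\<close> centred in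
        \<open>ball 0 R\<close> stay inside \<open>ball 0 (R + 1)\<close>, so the cutoff
        \<open>?B\<close> loses nothing.\<close>
      then have "norm h < R + 1" if "norm (h - y) < r" for h
        using that r norm_triangle_ineq[of "h - y" y] by auto
      then have "(\<integral>\<^sup>+h. ?i h y * ?B h \<partial>lborel) = (\<integral>\<^sup>+h. ?i h y \<partial>lborel)"
        by (intro nn_integral_cong) auto
      then show "(\<integral>\<^sup>+h. ?i h y * ?B h \<partial>lborel) = ennreal V"
        by (simp only: int_i)
    qed
    also have "\<dots> = ennreal (V * M)"
      using M V by (simp add: sp ennreal_mult)
    finally have lhs: "(\<integral>\<^sup>+h. \<phi> h * ?B h \<partial>lborel) = ennreal (V * M)" .
    have "(\<integral>\<^sup>+h. (\<phi> h)\<^sup>2 \<partial>lborel) = (\<integral>\<^sup>+h. (\<integral>\<^sup>+q. ?i h (fst q) * ?i h (snd q) \<partial>(\<mu> \<Otimes>\<^sub>M \<mu>)) \<partial>lborel)"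
    proof (rule nn_integral_cong)
      fix h
      have "(\<integral>\<^sup>+q. ?i h (fst q) * ?i h (snd q) \<partial>(\<mu> \<Otimes>\<^sub>M \<mu>)) = (\<integral>\<^sup>+y. (\<integral>\<^sup>+z. ?i h y * ?i h z \<partial>\<mu>) \<partial>\<mu>)"
        by (subst nn_integral_fst[symmetric]) auto
      also have "\<dots> = (\<integral>\<^sup>+y. ?i h y * \<phi> h \<partial>\<mu>)"
        unfolding \<phi>_def by (intro nn_integral_cong nn_integral_cmult) measurable
      also have "\<dots> = \<phi> h * \<phi> h"
        unfolding \<phi>_def by (rule nn_integral_multc) measurable
      finally show "(\<phi> h)\<^sup>2 = (\<integral>\<^sup>+q. ?i h (fst q) * ?i h (snd q) \<partial>(\<mu> \<Otimes>\<^sub>M \<mu>))"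
        by (simp add: power2_eq_square)
    qed
    also have "\<dots> = (\<integral>\<^sup>+q. (\<integral>\<^sup>+h. ?i h (fst q) * ?i h (snd q) \<partial>lborel) \<partial>(\<mu> \<Otimes>\<^sub>M \<mu>))"
      by (rule P2.Fubini'[symmetric]) measurable
    also have "\<dots> \<le> (\<integral>\<^sup>+q. ennreal V * (if norm (fst q - snd q) < 2 * r then 1 else 0) \<partial>(\<mu> \<Otimes>\<^sub>M \<mu>))"
    proof (rule nn_integral_mono)
      fix q :: "'a \<times> 'a"
      show "(\<integral>\<^sup>+h. ?i h (fst q) * ?i h (snd q) \<partial>lborel) \<le> ennreal V * (if norm (fst q - snd q) < 2 * r then 1 else 0)"
      proof (cases "norm (fst q - snd q) < 2 * r")
        case True
        have "(\<integral>\<^sup>+h. ?i h (fst q) * ?i h (snd q) \<partial>lborel) \<le> (\<integral>\<^sup>+h. ?i h (fst q) \<partial>lborel)"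
          by (intro nn_integral_mono) auto
        then show ?thesis using True unfolding int_i by simp
      next
        case False
        have "?i h (fst q) * ?i h (snd q) = 0" for h
          using False norm_triangle_ineq[of "fst q - h" "h - snd q"] norm_minus_commute[of h "fst q"] by auto
        then have "(\<integral>\<^sup>+h. ?i h (fst q) * ?i h (snd q) \<partial>lborel) = (\<integral>\<^sup>+h. 0 \<partial>(lborel::'a measure))"
          by (intro nn_integral_cong)
        then show ?thesis by (simp del: mult_eq_0_iff)
      qed
    qed
    also have "\<dots> = ennreal V * (\<integral>\<^sup>+x. (\<integral>\<^sup>+y. (if norm (x - y) < 2 * r then 1 else 0) \<partial>\<mu>) \<partial>\<mu>)"
      by (subst nn_integral_cmult, measurable) (subst nn_integral_fst[symmetric], auto)
    also have "\<dots> \<le> ennreal V * (ennreal ((2 * r) powr s) * energy s \<mu>)"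
      using r assms(4) by (intro mult_left_mono near_diagonal_le_energy) auto
    also have "\<dots> = ennreal (V * ((2 * r) powr s * e))"
      unfolding e(2) using V e(1) by (simp add: ennreal_mult)
    finally have sq: "(\<integral>\<^sup>+h. (\<phi> h)\<^sup>2 \<partial>lborel) \<le> ennreal (V * ((2 * r) powr s * e))" .
    have B2: "(\<integral>\<^sup>+h. (?B h)\<^sup>2 \<partial>lborel) = ennreal (\<beta> * (R + 1) ^ DIM('a))"
    proof -
      have "(\<integral>\<^sup>+h. (?B h)\<^sup>2 \<partial>lborel) = (\<integral>\<^sup>+h. indicator (ball (0::'a) (R + 1)) h \<partial>lborel)"
        by (intro nn_integral_cong) (auto simp: indicator_def)
      then show ?thesis using assms(1) by (simp add: vol)
    qed
    have "ennreal ((V * M)\<^sup>2) = (\<integral>\<^sup>+h. \<phi> h * ?B h \<partial>lborel)\<^sup>2"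
      unfolding lhs using V M by (simp add: ennreal_power)
    also have "\<dots> \<le> (\<integral>\<^sup>+h. (\<phi> h)\<^sup>2 \<partial>lborel) * (\<integral>\<^sup>+h. (?B h)\<^sup>2 \<partial>lborel)"
      by (rule Cauchy_Schwarz_nn_integral) measurable
    also have "\<dots> \<le> ennreal (V * ((2 * r) powr s * e)) * ennreal (\<beta> * (R + 1) ^ DIM('a))"
      unfolding B2 by (intro mult_right_mono sq) auto
    also have "\<dots> = ennreal (V * ((2 * r) powr s * e) * (\<beta> * (R + 1) ^ DIM('a)))"
      using V e(1) \<beta> assms(1) by (simp add: ennreal_mult)
    finally have "(V * M)\<^sup>2 \<le> V * ((2 * r) powr s * e) * (\<beta> * (R + 1) ^ DIM('a))"
      using V e(1) \<beta> assms(1) by (subst (asm) ennreal_le_iff) auto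
    then have "(V * \<beta>) * (r ^ DIM('a) * M\<^sup>2) \<le> (V * \<beta>) * ((2 * r) powr s * e * (R + 1) ^ DIM('a))"
      by (simp add: power2_eq_square V_def ac_simps)
    then have "r ^ DIM('a) * M\<^sup>2 \<le> (2 * r) powr s * e * (R + 1) ^ DIM('a)"
      using V \<beta> by (simp only: mult_le_cancel_left_pos mult_pos_pos)
    then have "M\<^sup>2 \<le> (2 * r) powr s * e * (R + 1) ^ DIM('a) / r ^ DIM('a)"
      using r by (simp add: field_simps)
    also have "(2 * r) powr s * e * (R + 1) ^ DIM('a) / r ^ DIM('a) = ((R + 1) ^ DIM('a) * 2 powr s * e) * (r powr s / r ^ DIM('a))"
      using r by (simp add: powr_mult)
    also have "r powr s / r ^ DIM('a) = r powr (s - real DIM('a))"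
      using r by (simp add: powr_diff powr_realpow)
    finally show ?thesis .
  qed
  have "(\<lambda>k. ((R + 1) ^ DIM('a) * 2 powr s * e) * ((1/2)^k) powr (s - real DIM('a))) \<longlonglongrightarrow> ((R + 1) ^ DIM('a) * 2 powr s * e) * 0 powr (s - real DIM('a))"
    using assms(4) by (intro tendsto_intros LIMSEQ_power_zero tendsto_powr') auto
  then have "M\<^sup>2 \<le> ((R + 1) ^ DIM('a) * 2 powr s * e) * 0 powr (s - real DIM('a))"
    by (rule LIMSEQ_le_const) (intro exI[of _ 0] allI impI main, auto simp: power_le_one)
  then have "M = 0" by simp
  then show ?thesis using M(1) by simp
qed

section \<open>Summation over dyadic scales\<close>

lemma oscillation_less_top:
  assumes "r > 0"
  shows "oscillation r x < \<infinity>"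
proof -
  define B where "B = (\<lambda>a. a powr (-(real DIM('a) - 1)/2) * measure \<mu> (space \<mu>))"
  have "oscillation r x \<le> (\<integral>\<^sup>+v. ennreal (B (r\<^sup>2/4) + B (r\<^sup>2)) * ennreal (exp (- (pi * 1 * (norm (v - (0::'a)))\<^sup>2))) \<partial>lborel)"
    unfolding oscillation_def
  proof (rule nn_integral_mono)
    fix v :: 'a
    have "smoothing (r\<^sup>2/4) v x \<le> B (r\<^sup>2/4)" "smoothing (r\<^sup>2) v x \<le> B (r\<^sup>2)"
      unfolding B_def by (rule smoothing_le, use assms in simp)+
    then have "\<bar>smoothing (r\<^sup>2/4) v x - smoothing (r\<^sup>2) v x\<bar> \<le> B (r\<^sup>2/4) + B (r\<^sup>2)"
      using smoothing_nonneg[of "r\<^sup>2/4" v x] smoothing_nonneg[of "r\<^sup>2" v x] by linarith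
    then have "gauss_weight v * \<bar>smoothing (r\<^sup>2/4) v x - smoothing (r\<^sup>2) v x\<bar> \<le> (B (r\<^sup>2/4) + B (r\<^sup>2)) * gauss_weight v"
      by (subst mult.commute) (intro mult_right_mono, auto)
    then show "ennreal (gauss_weight v * \<bar>smoothing (r\<^sup>2/4) v x - smoothing (r\<^sup>2) v x\<bar>)
       \<le> ennreal (B (r\<^sup>2/4) + B (r\<^sup>2)) * ennreal (exp (- (pi * 1 * (norm (v - (0::'a)))\<^sup>2)))"
      by (simp add: ennreal_mult''[symmetric] gauss_weight_def ennreal_leI)
  qed
  also have "\<dots> = ennreal (B (r\<^sup>2/4) + B (r\<^sup>2)) * ennreal (1 powr (-(real DIM('a))/2))"
    by (subst nn_integral_cmult, measurable) (simp only: nn_integral_gaussian[OF zero_less_one])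
  also have "\<dots> < \<infinity>" by (simp add: ennreal_mult_less_top)
  finally show ?thesis .
qed

text \<open>A Borel-Cantelli argument: where the sum diverges,
  \<open>oscillation ((1/2)^k) x\<close> is at least \<open>p ^ k\<close> for arbitrarily large
  \<open>k\<close>, and by \<open>oscillation_content\<close> the contents of these level sets decay
  geometrically.\<close>

lemma hausdorff_measure_divergent_oscillation:
  assumes s: "real DIM('a) - 1 < s" "s \<le> real DIM('a) + 1"
    and t: "0 < t" "t < real DIM('a) - 1" "2 * (real DIM('a) - 1) - s < t"
    and en: "energy s \<mu> < \<infinity>"
  shows "hausdorff_measure t {x. (\<Sum>k. oscillation ((1/2)^k) x) = \<infinity>} = 0"
proof (rule hausdorff_measure_zeroI)
  fix \<delta> :: real assume \<delta>: "\<delta> > 0"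
  define \<zeta> where "\<zeta> = s + t - 2 * (real DIM('a) - 1)"
  have \<zeta>: "\<zeta> > 0" using t unfolding \<zeta>_def by linarith
  obtain C where C: "C \<ge> 0" "\<And>E r \<delta>. bounded E \<Longrightarrow> 0 < r \<Longrightarrow> r \<le> 1 \<Longrightarrow> 0 < \<delta> \<Longrightarrow>
      (\<And>x. x \<in> E \<Longrightarrow> oscillation r x \<ge> ennreal (r powr (\<zeta>/4))) \<Longrightarrow>
      C * r powr (\<zeta>/2) \<le> \<delta> powr t \<Longrightarrow> hausdorff_pre t \<delta> E \<le> ennreal (C * r powr (\<zeta>/2))"
    using oscillation_content[OF s t en] unfolding \<zeta>_def by blast
  define D where "D = {x. (\<Sum>k. oscillation ((1/2)^k) x) = \<infinity>}"
  \<comment> \<open>\<open>q\<close> and \<open>p\<close> are the values of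
    \<open>r powr (\<zeta>/2)\<close> and \<open>r powr (\<zeta>/4)\<close> at
    \<open>r = 1/2\<close>.\<close>
  define q where "q = 2 powr (- (\<zeta>/2))"
  define p where "p = 2 powr (- (\<zeta>/4))"
  have q: "0 < q" "q < 1" using \<zeta> by (auto simp: q_def powr_less_one)
  have p: "0 < p" "p < 1" using \<zeta> by (auto simp: p_def powr_less_one)
  have half: "((1/2::real)^k) powr a = (2 powr (- a))^k" for k a
  proof -
    have "(1/2::real)^k = 2 powr (- real k)"
      by (simp add: powr_minus powr_realpow power_one_over inverse_eq_divide)
    moreover have "(2 powr (- a))^k = (2 powr (- a)) powr real k"
      by (simp add: powr_realpow)
    ultimately show ?thesis by (simp add: powr_powr mult.commute)
  qed
  \<comment> \<open>Cutting with balls supplies the boundedness that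
    \<open>oscillation_content\<close> asks for.\<close>
  define E where "E = (\<lambda>n k. {x. ennreal (p ^ k) \<le> oscillation ((1/2)^k) x} \<inter> ball 0 (real n))"
  have sub: "D \<inter> ball 0 (real n) \<subseteq> (\<Union>k. E n (k + K))" for n K
  proof (rule ccontr)
    assume "\<not> D \<inter> ball 0 (real n) \<subseteq> (\<Union>k. E n (k + K))"
    then obtain x where x: "x \<in> D" "x \<in> ball 0 (real n)" "\<And>k. x \<notin> E n (k + K)" by blast
    have small: "oscillation ((1/2)^(k + K)) x \<le> ennreal (p ^ (k + K))" for k
      using x(2) x(3)[of k] by (auto simp: E_def not_le less_imp_le)
    define o' where "o' = (\<lambda>k. enn2real (oscillation ((1/2)^k) x))"
    have o': "oscillation ((1/2)^k) x = ennreal (o' k)" "0 \<le> o' k" for k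
      using oscillation_less_top[of "(1/2)^k" x] by (auto simp: o'_def)
    have sg: "summable (\<lambda>k. p ^ (k + K))"
      using p by (subst summable_iff_shift) (intro summable_geometric, simp)
    have le: "o' (k + K) \<le> p ^ (k + K)" for k
      using small[of k] p unfolding o'(1) by (subst (asm) ennreal_le_iff) auto
    have "summable (\<lambda>k. o' (k + K))"
      by (rule summable_comparison_test'[OF sg, where N = 0]) (use o'(2) le in simp)
    then have "summable o'" by (rule summable_iff_shift[THEN iffD1])
    then have "(\<Sum>k. oscillation ((1/2)^k) x) \<noteq> \<infinity>"
      unfolding o'(1) using o'(2) by (subst suminf_ennreal2) auto
    then show False using x(1) by (simp add: D_def)
  qed
  have "hausdorff_pre t \<delta> (D \<inter> ball 0 (real n)) = 0" for n
  proof -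
    have "hausdorff_pre t \<delta> (D \<inter> ball 0 (real n)) \<le> 0 + ennreal \<epsilon>" if \<epsilon>: "\<epsilon> > 0" for \<epsilon>
    proof -
      \<comment> \<open>\<open>K\<close> has to meet two demands: the smallness condition relative
        to \<open>\<delta>\<close> at all scales from \<open>K\<close> on, and a geometric tail
        below \<open>\<epsilon>\<close>.\<close>
      have "(\<lambda>K. C * q ^ K) \<longlonglongrightarrow> C * 0"
        using q by (intro tendsto_intros LIMSEQ_power_zero) auto
      then have "\<forall>\<^sub>F K in sequentially. C * q ^ K < min (\<delta> powr t) (\<epsilon> * (1 - q))"
        using \<epsilon> \<delta> q by (intro order_tendstoD(2)[of _ "C * 0"]) auto
      then obtain K where K: "C * q ^ K < min (\<delta> powr t) (\<epsilon> * (1 - q))"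
        by (auto simp: eventually_sequentially)
      have Ek: "hausdorff_pre t \<delta> (E n (k + K)) \<le> ennreal (C * q ^ K * q ^ k)" for k
      proof -
        have "C * q ^ (k + K) \<le> C * q ^ K"
          using C(1) q by (intro mult_left_mono power_decreasing) auto
        then have "C * ((1/2) ^ (k + K)) powr (\<zeta>/2) \<le> \<delta> powr t"
          using K unfolding half q_def[symmetric] by simp
        then have "hausdorff_pre t \<delta> (E n (k + K)) \<le> ennreal (C * ((1/2) ^ (k + K)) powr (\<zeta>/2))"
          using \<delta> by (intro C(2)) (auto simp: E_def half p_def power_le_one intro: bounded_subset[OF bounded_ball])
        then show ?thesis
          unfolding half q_def[symmetric] by (simp add: power_add ac_simps)
      qed
      have "hausdorff_pre t \<delta> (D \<inter> ball 0 (real n)) \<le> hausdorff_pre t \<delta> (\<Union>k. E n (k + K))"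
        by (intro hausdorff_pre_mono sub)
      also have "\<dots> \<le> (\<Sum>k. hausdorff_pre t \<delta> (E n (k + K)))" by (rule hausdorff_pre_UN_le)
      also have "\<dots> \<le> (\<Sum>k. ennreal (C * q ^ K * q ^ k))" by (intro suminf_le Ek) auto
      also have "\<dots> = ennreal (C * q ^ K * (1 / (1 - q)))"
        using C(1) q by (intro suminf_ennreal_eq sums_mult geometric_sums) auto
      also have "\<dots> \<le> ennreal \<epsilon>"
        using K q by (intro ennreal_leI) (simp add: field_simps)
      finally show ?thesis by simp
    qed
    then have "hausdorff_pre t \<delta> (D \<inter> ball 0 (real n)) \<le> 0"
      by (rule ennreal_le_epsilon)
    then show ?thesis by simp
  qed
  moreover have "D = (\<Union>n. D \<inter> ball 0 (real n))"
  proof -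
    have "\<exists>n. x \<in> ball 0 (real n)" for x :: 'a
      using reals_Archimedean2[of "norm x"] by auto
    then show ?thesis by blast
  qed
  ultimately have "hausdorff_pre t \<delta> D \<le> 0"
    using hausdorff_pre_UN_le[of t \<delta> "\<lambda>n. D \<inter> ball 0 (real n)"] by simp
  then show "hausdorff_pre t \<delta> {x. (\<Sum>k. oscillation ((1/2)^k) x) = \<infinity>} = 0" by (simp add: D_def)
qed

end

theorem theorem1p1:
  fixes \<mu> :: "'a::euclidean_space measure" and s :: real
  assumes "DIM('a) \<ge> 2"
    and "sets \<mu> = sets borel"
    and "\<And>K. compact K \<Longrightarrow> emeasure \<mu> K < \<infinity>"
    and "compact (spt \<mu>)"
    and "s > real (DIM('a)) - 1"
    and "energy s \<mu> < \<infinity>"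
  shows "hausdorff_dim (exc_set \<mu>) \<le> ereal (2 * (real (DIM('a)) - 1) - s)"
proof -
  have sp: "space \<mu> = UNIV" using sets_eq_imp_space_eq[OF assms(2)] by simp
  have cl: "spt \<mu> \<in> sets borel" "- spt \<mu> \<in> sets borel"
    using assms(4) by (auto intro!: borel_closed borel_comp compact_imp_closed)
  \<comment> \<open>Finiteness on compact sets becomes finiteness of \<open>\<mu>\<close>, because
    the support is compact and its complement is null.\<close>
  have "emeasure \<mu> UNIV \<le> emeasure \<mu> (spt \<mu>) + emeasure \<mu> (- spt \<mu>)"
    using emeasure_subadditive[of "spt \<mu>" \<mu> "- spt \<mu>"] cl assms(2) by simp
  also have "\<dots> < \<infinity>"
    using assms(3)[OF assms(4)] emeasure_outside_spt[OF assms(2)] by simp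
  finally have fin: "emeasure \<mu> UNIV < \<infinity>" .
  have "finite_measure \<mu>" using fin unfolding sp[symmetric] by (intro finite_measureI) simp
  then interpret finite_euclidean_measure \<mu>
    using assms(2) by (intro finite_euclidean_measure.intro finite_euclidean_measure_axioms.intro)
  show ?thesis
  \<comment> \<open>For \<open>s \<le> DIM('a)\<close> the claimed bound is at least
    \<open>DIM('a) - 2\<close>, hence nonnegative as \<open>hausdorff_dim_le\<close> demands. For
    larger \<open>s\<close> it may be negative, but then \<open>\<mu>\<close> vanishes.\<close>
  proof (cases "s \<le> real DIM('a)")
    case True
    have sub: "exc_set \<mu> \<subseteq> {x. (\<Sum>k. oscillation ((1/2)^k) x) = \<infinity>}"
      using ac_sphere_hausdorff_if_summable_oscillation[OF assms(1,6)]
      by (auto simp: exc_set_def less_top[symmetric])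
    show ?thesis
    proof (rule hausdorff_dim_le)
      have d2: "real DIM('a) \<ge> 2" using assms(1) by simp
      show "0 \<le> 2 * (real DIM('a) - 1) - s" using add_mono[OF True d2] by (simp add: algebra_simps)
      show "2 * (real DIM('a) - 1) - s < real DIM('a) - 1" using assms(5) by (simp add: algebra_simps)
      fix t assume t: "2 * (real DIM('a) - 1) - s < t" "t < real DIM('a) - 1"
      have "hausdorff_measure t {x. (\<Sum>k. oscillation ((1/2)^k) x) = \<infinity>} = 0"
        using True d2 assms(5,6) t by (intro hausdorff_measure_divergent_oscillation[of s]) auto
      then have "hausdorff_pre t \<delta> (exc_set \<mu>) = 0" if "\<delta> > 0" for \<delta>
        using hausdorff_pre_mono[OF sub, of t \<delta>] hausdorff_pre_le_measure[OF that, of t "{x. (\<Sum>k. oscillation ((1/2)^k) x) = \<infinity>}"]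
        by simp
      then show "hausdorff_measure t (exc_set \<mu>) = 0" by (rule hausdorff_measure_zeroI)
    qed
  next
    case False
    obtain R where R: "0 < R" "spt \<mu> \<subseteq> ball 0 R"
      using bounded_subset_ballD[OF compact_imp_bounded[OF assms(4)]] by blast
    have "emeasure \<mu> (- ball 0 R) \<le> emeasure \<mu> (- spt \<mu>)"
      using R cl assms(2) by (intro emeasure_mono) auto
    then have "emeasure \<mu> UNIV = 0"
      using zero_measure_if_energy_above_dimension[OF R(1) _ assms(6)] False emeasure_outside_spt[OF assms(2)] by simp
    then have "emeasure \<mu> A = 0" for A
      using emeasure_mono[of A UNIV \<mu>] assms(2) by simp
    \<comment> \<open>The zero measure is absolutely continuous from every \<open>x\<close>; the
      empty set has dimension minus infinity, so the bound holds whatever its sign.\<close>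
    then have "exc_set \<mu> = {}"
      unfolding exc_set_def ac_sphere_hausdorff_def
      by (auto simp: emeasure_distr emeasure_notin_sets distr_def emeasure_measure_of_conv)
    then show ?thesis by (simp add: hausdorff_dim_def)
  qed
qed

end
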